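(* Let $\mathcal{H}$ be a Hilbert space and let $K\subset\mathcal{H}$ be an ellipsoid such that the sequence $\{d_n(K)\}$ of Kolmogorov widths is not lacunary. Then $WG(K)=\mathcal{L}(\mathcal{H})$.
   Context: An ellipsoid in a Hilbert space $\mathcal{H}$ is a set of the form $A(B_{\mathcal{H}'})$, where $\mathcal{H}'$ is a Hilbert space, $B_{\mathcal{H}'}$ its closed unit ball, and $A:\mathcal{H}'\to\mathcal{H}$ a compact linear operator with infinite-dimensional range. $\mathcal{L}(\mathcal{H})$ is the space of bounded linear operators on $\mathcal{H}$; $G(K)=\{D\in\mathcal{L}(\mathcal{H}): DK\supset K\}$; $WG(K)$ is the closure of $G(K)$ in the weak operator topology. The Kolmogorov $n$-width is $d_n(K)=\inf_{\mathcal{X}_n}\sup_{x\in K}\inf_{z\in \mathcal{X}_n}\|x-z\|$, the outer infimum being over all $n$-dimensional linear subspaces $\mathcal{X}_n$ of $\mathcal{H}$. A non-increasing sequence $\{a_n\}$ of positive numbers with $\lim a_n=0$ is called lacunary if $\liminf_{n\to\infty}a_{n+1}/a_n=0$. *)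

theory Defs
  imports "HOL-Analysis.Analysis"
begin

text \<open>
  The scalar field of a Hilbert space is the real or the complex numbers. Both are treated
  at once through the following class, whose axioms force the field to be one of the two:
  they make \<open>x + scalar_cnj x\<close> real, and every nonzero \<open>x\<close> with
  \<open>scalar_cnj x = - x\<close> a real multiple of a square root of -1.
\<close>

class rc_scalar = real_normed_field +
  fixes scalar_cnj :: "'a \<Rightarrow> 'a"
  assumes scalar_cnj_add: "scalar_cnj (x + y) = scalar_cnj x + scalar_cnj y"
    and scalar_cnj_mult: "scalar_cnj (x * y) = scalar_cnj x * scalar_cnj y"
    and scalar_cnj_cnj: "scalar_cnj (scalar_cnj x) = x"
    and mult_scalar_cnj: "x * scalar_cnj x = scaleR ((norm x)\<^sup>2) 1"

instantiation real :: rc_scalar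
begin
definition scalar_cnj_real :: "real \<Rightarrow> real" where "scalar_cnj_real x = x"
instance by standard (auto simp: scalar_cnj_real_def power2_eq_square)
end

instantiation complex :: rc_scalar
begin
definition scalar_cnj_complex :: "complex \<Rightarrow> complex" where "scalar_cnj_complex = cnj"
instance by standard (auto simp: scalar_cnj_complex_def complex_norm_square scaleR_conv_of_real simp flip: of_real_power)
end

text \<open>
  A Hilbert space over \<open>'k\<close>: norm, completeness and the underlying real vector space come
  from the type class of \<open>'h\<close>; scalar multiplication \<open>scl\<close> and inner product \<open>ip\<close>
  (linear in the first argument) are parameters compatible with them.
\<close>

locale hilbert_space = vector_space scl
  for scl :: "'k::rc_scalar \<Rightarrow> 'h::banach \<Rightarrow> 'h" +
  fixes ip :: "'h \<Rightarrow> 'h \<Rightarrow> 'k"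
  assumes scl_of_real: "scl (of_real r) x = r *\<^sub>R x"
    and ip_add_left: "ip (x + y) z = ip x z + ip y z"
    and ip_scl_left: "ip (scl c x) y = c * ip x y"
    and ip_commute: "ip y x = scalar_cnj (ip x y)"
    and ip_self: "ip x x = of_real ((norm x)\<^sup>2)"

lemma hilbert_space_real:
  "hilbert_space scaleR (inner :: 'h::{real_inner,banach} \<Rightarrow> 'h \<Rightarrow> real)"
  by unfold_locales
    (auto simp: algebra_simps inner_commute scalar_cnj_real_def power2_norm_eq_inner)

lemma hilbert_space_complex: "hilbert_space (*) (\<lambda>x y :: complex. x * cnj y)"
  by unfold_locales
    (auto simp: algebra_simps scalar_cnj_complex_def scaleR_conv_of_real complex_norm_square simp flip: of_real_power)

text \<open>
  The library's type of bounded linear maps only knows real linearity, so linearity over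
  \<open>'k\<close> is imposed by cutting out a subset.
\<close>

definition bounded_ops ::
  "('k \<Rightarrow> 'a::real_normed_vector \<Rightarrow> 'a) \<Rightarrow> ('k \<Rightarrow> 'b::real_normed_vector \<Rightarrow> 'b) \<Rightarrow> ('a \<Rightarrow>\<^sub>L 'b) set"
  where "bounded_ops scl1 scl2 =
    {T. \<forall>c x. blinfun_apply T (scl1 c x) = scl2 c (blinfun_apply T x)}"

definition compact_op :: "('a::real_normed_vector \<Rightarrow>\<^sub>L 'b::real_normed_vector) \<Rightarrow> bool"
  where "compact_op T \<longleftrightarrow> compact (closure (blinfun_apply T ` cball 0 1))"

definition ndim_subspace ::
  "('k::field \<Rightarrow> 'h::ab_group_add \<Rightarrow> 'h) \<Rightarrow> nat \<Rightarrow> 'h set \<Rightarrow> bool"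
  where "ndim_subspace scl n X \<longleftrightarrow>
    (\<exists>B. finite B \<and> card B = n \<and> \<not> module.dependent scl B \<and> X = module.span scl B)"

text \<open>
  \<open>K\<close> is the ellipsoid \<open>A(B)\<close>, with \<open>B\<close> the closed unit ball of the Hilbert space on
  which \<open>A\<close> is defined. That space ranges over arbitrary types, so it cannot be
  existentially quantified here and \<open>A\<close> is a parameter.
\<close>

definition ellipsoid_of ::
  "('k::rc_scalar \<Rightarrow> 'g::banach \<Rightarrow> 'g) \<Rightarrow> ('k \<Rightarrow> 'h::banach \<Rightarrow> 'h) \<Rightarrow> ('g \<Rightarrow>\<^sub>L 'h) \<Rightarrow> 'h set \<Rightarrow> bool"
  where "ellipsoid_of scl' scl A K \<longleftrightarrow>
    A \<in> bounded_ops scl' scl \<and> compact_op A \<and>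
    (\<nexists>n. ndim_subspace scl n (range (blinfun_apply A))) \<and>
    K = blinfun_apply A ` cball 0 1"

text \<open>
  The infima and the supremum are real-valued; for a bounded nonempty \<open>K\<close> in an
  infinite-dimensional space they are taken over nonempty bounded sets.
\<close>

definition kolmogorov_width ::
  "('k::field \<Rightarrow> 'h::real_normed_vector \<Rightarrow> 'h) \<Rightarrow> 'h set \<Rightarrow> nat \<Rightarrow> real"
  where "kolmogorov_width scl K n =
    (INF X \<in> {X. ndim_subspace scl n X}. SUP x \<in> K. INF z \<in> X. norm (x - z))"

text \<open>
  The first three conditions are the domain on which lacunarity is defined; they hold
  for the widths of every ellipsoid.
\<close>

definition lacunary :: "(nat \<Rightarrow> real) \<Rightarrow> bool"
  where "lacunary a \<longleftrightarrow>
    decseq a \<and> (\<forall>n. a n > 0) \<and> a \<longlonglongrightarrow> 0 \<and>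
    liminf (\<lambda>n. ereal (a (Suc n) / a n)) = 0"

definition weak_operator_topology ::
  "('k::rc_scalar \<Rightarrow> 'h::banach \<Rightarrow> 'h) \<Rightarrow> ('h \<Rightarrow> 'h \<Rightarrow> 'k) \<Rightarrow> ('h \<Rightarrow>\<^sub>L 'h) topology"
  where "weak_operator_topology scl ip =
    pullback_topology (bounded_ops scl scl)
      (\<lambda>T (x, y). ip (blinfun_apply T x) y) euclidean"

definition covering_ops ::
  "('k::rc_scalar \<Rightarrow> 'h::banach \<Rightarrow> 'h) \<Rightarrow> 'h set \<Rightarrow> ('h \<Rightarrow>\<^sub>L 'h) set"
  where "covering_ops scl K = {D \<in> bounded_ops scl scl. K \<subseteq> blinfun_apply D ` K}"

definition wot_covering_ops ::
  "('k::rc_scalar \<Rightarrow> 'h::banach \<Rightarrow> 'h) \<Rightarrow> ('h \<Rightarrow> 'h \<Rightarrow> 'k) \<Rightarrow> 'h set \<Rightarrow> ('h \<Rightarrow>\<^sub>L 'h) set"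
  where "wot_covering_ops scl ip K =
    weak_operator_topology scl ip closure_of covering_ops scl K"

end

theory Submission
  imports Defs
begin

text \<open>
  Choosing unit vectors \<open>g 0, g 1, \<dots>\<close> greedily, each maximizing \<open>norm (A w)\<close> on the
  orthogonal complement of its predecessors, yields an orthonormal sequence with orthogonal images,
  and the \<open>n\<close>-th width of \<open>K\<close> is \<open>s n = norm (A (g n))\<close>; so non-lacunarity means
  \<open>c * s n \<le> s (n + 1)\<close> for some \<open>c > 0\<close>. Given an operator \<open>T\<close> and a subspace \<open>F\<close> of
  dimension \<open>m\<close>, restrict \<open>A\<close> to the vectors it maps into the orthogonal complement of \<open>F\<close>. This
  subspace has codimension at most \<open>m\<close>, so the maxima \<open>t n\<close> of the greedy choice inside it satisfy
  \<open>c ^ m * s n \<le> s (n + m) \<le> t n\<close>. Hence the operator which equals \<open>T\<close> on \<open>F\<close> and, on the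
  orthogonal complement of \<open>F\<close>, is \<open>c ^ (- m)\<close> times the partial isometry matching the two
  sequences of normalized images maps the part of \<open>K\<close> orthogonal to \<open>F\<close> onto a superset of \<open>K\<close>.
  As every basic weak operator neighbourhood of \<open>T\<close> involves finitely many vectors only, exact
  agreement on \<open>F\<close> is more than enough.
\<close>

section \<open>Linear algebra: underdetermined homogeneous systems\<close>

text \<open>Gaussian elimination, by induction on the set of equations: one equation is used to
  eliminate one unknown \<open>p\<close>, which leaves fewer equations than unknowns.\<close>

lemma homogeneous_system_nontrivial:
  fixes M :: "'i \<Rightarrow> 'j \<Rightarrow> 'k::field"
  assumes "finite I" "finite J" "card I < card J"
  shows "\<exists>a. (\<exists>j\<in>J. a j \<noteq> 0) \<and> (\<forall>i\<in>I. (\<Sum>j\<in>J. a j * M i j) = 0)"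
  using assms
proof (induction I arbitrary: J M rule: finite_induct)
  case empty
  then obtain j where "j \<in> J" by fastforce
  then show ?case by (intro exI[of _ "\<lambda>_. 1"]) auto
next
  case (insert i0 I)
  \<comment> \<open>If equation \<open>i0\<close> is trivial, any \<open>p\<close> will do: division
    by zero then makes every \<open>q j\<close> equal to 0, and the identity \<open>q\<close> below
    still holds.\<close>
  obtain p where p: "p \<in> J" "(\<exists>j\<in>J. M i0 j \<noteq> 0) \<Longrightarrow> M i0 p \<noteq> 0"
    using insert.prems by (cases "\<exists>j\<in>J. M i0 j \<noteq> 0") fastforce+
  define J' where "J' = J - {p}"
  have J': "finite J'" "card I < card J'" "p \<notin> J'" "J = insert p J'"
    using insert.prems insert.hyps p by (auto simp: J'_def)
  define q where "q j = M i0 j / M i0 p" for j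
  have q: "M i0 j = q j * M i0 p" if "j \<in> J" for j
    using p that by (auto simp: q_def)
  from insert.IH[OF J'(1,2), of "\<lambda>i j. M i j - q j * M i p"] obtain a where
    a: "\<exists>j\<in>J'. a j \<noteq> 0" "\<And>i. i \<in> I \<Longrightarrow> (\<Sum>j\<in>J'. a j * (M i j - q j * M i p)) = 0"
    by blast
  \<comment> \<open>The value at \<open>p\<close> is the one that turns a solution of the reduced
    system into a solution of the original one.\<close>
  define b where "b = a(p := - (\<Sum>j\<in>J'. a j * q j))"
  have b: "(\<Sum>j\<in>J. b j * M i j) = (\<Sum>j\<in>J'. a j * (M i j - q j * M i p))" for i
  proof -
    have "(\<Sum>j\<in>J. b j * M i j) = b p * M i p + (\<Sum>j\<in>J'. b j * M i j)"
      using J' by simp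
    also have "(\<Sum>j\<in>J'. b j * M i j) = (\<Sum>j\<in>J'. a j * M i j)"
      using J' by (intro sum.cong) (auto simp: b_def)
    also have "b p * M i p = - (\<Sum>j\<in>J'. a j * q j * M i p)"
      by (simp add: b_def sum_distrib_right)
    finally show ?thesis by (simp add: algebra_simps sum_subtractf)
  qed
  have "(\<Sum>j\<in>J'. a j * (M i0 j - q j * M i0 p)) = 0"
    using q J' by (intro sum.neutral) (metis insertCI mult_zero_right right_minus_eq)
  then have "\<forall>i\<in>insert i0 I. (\<Sum>j\<in>J. b j * M i j) = 0"
    using a(2) b by simp
  moreover have "\<exists>j\<in>J. b j \<noteq> 0" using a(1) J' by (auto simp: b_def)
  ultimately show ?case by blast
qed

subsection \<open>Orthonormal families in Hilbert spaces\<close>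

lemma scalar_cnj_0 [simp]: "scalar_cnj (0::'k::rc_scalar) = 0"
  using scalar_cnj_add[of "0::'k" 0] by simp

lemma scalar_cnj_of_real [simp]: "scalar_cnj (of_real r::'k::rc_scalar) = of_real r"
proof (cases "r = 0")
  case False
  have "of_real r * scalar_cnj (of_real r::'k) = of_real r * of_real r"
    using mult_scalar_cnj[of "of_real r::'k"]
    by (simp add: scaleR_conv_of_real power2_eq_square flip: of_real_mult)
  then show ?thesis using False by simp
qed simp

lemma mult_scalar_cnj_of_real: "x * scalar_cnj x = (of_real ((norm x)\<^sup>2)::'k::rc_scalar)"
  using mult_scalar_cnj[of x] by (simp add: scaleR_conv_of_real)

lemma norm_scalar_cnj [simp]: "norm (scalar_cnj (x::'k::rc_scalar)) = norm x"
proof (cases "x = 0")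
  case False
  have "norm x * norm (scalar_cnj x) = norm x * norm x"
    using arg_cong[OF mult_scalar_cnj_of_real[of x], of norm]
    by (simp add: norm_mult power2_eq_square)
  then show ?thesis using False by simp
qed simp

context hilbert_space
begin

lemma scl_of_real_mult: "scl (of_real r * c) x = r *\<^sub>R scl c x"
  by (metis scale_scale scl_of_real)

lemma ip_add_right: "ip x (y + z) = ip x y + ip x z"
  by (metis ip_commute ip_add_left scalar_cnj_add)

lemma ip_scl_right: "ip x (scl c y) = scalar_cnj c * ip x y"
  by (metis ip_commute ip_scl_left scalar_cnj_mult)

lemma ip_zero_left [simp]: "ip 0 x = 0"
  using ip_add_left[of 0 0 x] by simp

lemma ip_zero_right [simp]: "ip x 0 = 0"
  using ip_add_right[of x 0 0] by simp

lemma ip_minus_left: "ip (- x) y = - ip x y"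
  using ip_add_left[of x "- x" y] by (simp add: eq_neg_iff_add_eq_0 add.commute)

lemma ip_minus_right: "ip x (- y) = - ip x y"
  using ip_add_right[of x y "- y"] by (simp add: eq_neg_iff_add_eq_0 add.commute)

lemma ip_diff_left: "ip (x - y) z = ip x z - ip y z"
  using ip_add_left[of x "- y" z] by (simp add: ip_minus_left)

lemma ip_diff_right: "ip x (y - z) = ip x y - ip x z"
  using ip_add_right[of x y "- z"] by (simp add: ip_minus_right)

lemma ip_scaleR_left: "ip (r *\<^sub>R x) y = r *\<^sub>R ip x y"
  by (metis ip_scl_left scl_of_real scaleR_conv_of_real)

lemma ip_sum_left: "ip (sum f S) y = (\<Sum>i\<in>S. ip (f i) y)"
  by (induction S rule: infinite_finite_induct) (auto simp: ip_add_left)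

lemma ip_zero_commute: "ip x y = 0 \<longleftrightarrow> ip y x = 0"
  by (metis ip_commute scalar_cnj_0)

lemma norm_scl: "norm (scl c x) = norm c * norm x"
proof -
  have "(of_real ((norm (scl c x))\<^sup>2) :: 'k) = (c * scalar_cnj c) * ip x x"
    by (simp only: ip_self[symmetric] ip_scl_left ip_scl_right mult_ac)
  also have "\<dots> = of_real ((norm c * norm x)\<^sup>2)"
    by (simp only: mult_scalar_cnj_of_real ip_self power_mult_distrib of_real_mult)
  finally have "(norm (scl c x))\<^sup>2 = (norm c * norm x)\<^sup>2"
    by (simp only: of_real_eq_iff)
  then show ?thesis by (simp add: power2_eq_iff_nonneg)
qed

text \<open>The cross term is \<open>ip x y\<close> plus its conjugate. Assuming
  \<open>ip x y\<close> real avoids speaking of real parts over the abstract scalar field.\<close>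

lemma norm_add_sq_of_ip:
  assumes "ip x y = of_real r"
  shows "(norm (x + y))\<^sup>2 = (norm x)\<^sup>2 + 2 * r + (norm y)\<^sup>2"
proof -
  have "ip y x = of_real r" using assms ip_commute[of y x] by simp
  then have "(of_real ((norm (x + y))\<^sup>2) :: 'k) = of_real ((norm x)\<^sup>2 + 2 * r + (norm y)\<^sup>2)"
    by (simp only: ip_self[symmetric] ip_add_left ip_add_right)
      (simp add: assms ip_self)
  then show ?thesis by (simp only: of_real_eq_iff)
qed

lemma pythagoras: "ip x y = 0 \<Longrightarrow> (norm (x + y))\<^sup>2 = (norm x)\<^sup>2 + (norm y)\<^sup>2"
  using norm_add_sq_of_ip[of x y 0] by simp

lemma parallelogram:
  fixes x y :: 'h
  shows "(norm (x + y))\<^sup>2 + (norm (x - y))\<^sup>2 = 2 * (norm x)\<^sup>2 + 2 * (norm y)\<^sup>2"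
proof -
  have "(of_real ((norm (x + y))\<^sup>2 + (norm (x - y))\<^sup>2) :: 'k)
      = of_real (2 * (norm x)\<^sup>2 + 2 * (norm y)\<^sup>2)"
    unfolding of_real_add of_real_mult ip_self[symmetric]
    by (simp add: ip_add_left ip_add_right ip_diff_left ip_diff_right)
  then show ?thesis by (simp only: of_real_eq_iff)
qed

section \<open>Finite orthonormal families\<close>

definition orthonormal_on :: "'i set \<Rightarrow> ('i \<Rightarrow> 'h) \<Rightarrow> bool" where
  "orthonormal_on I e \<longleftrightarrow> (\<forall>i\<in>I. norm (e i) = 1) \<and> (\<forall>i\<in>I. \<forall>j\<in>I. i \<noteq> j \<longrightarrow> ip (e i) (e j) = 0)"

lemma orthonormal_on_subset: "orthonormal_on I e \<Longrightarrow> J \<subseteq> I \<Longrightarrow> orthonormal_on J e"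
  by (simp add: orthonormal_on_def subset_iff)

lemma ip_orthonormal:
  assumes "orthonormal_on I e" "i \<in> I" "j \<in> I"
  shows "ip (e i) (e j) = (if i = j then 1 else 0)"
  using assms ip_self[of "e i"] by (auto simp: orthonormal_on_def)

lemma inj_on_orthonormal:
  assumes "orthonormal_on I e"
  shows "inj_on e I"
proof (rule inj_onI, rule ccontr)
  fix i j assume "i \<in> I" "j \<in> I" "e i = e j" "i \<noteq> j"
  then show False
    using ip_orthonormal[OF assms, of i j] ip_orthonormal[OF assms, of i i] by simp
qed

lemma norm_orthogonal_sum:
  assumes "finite I" "\<And>i j. i \<in> I \<Longrightarrow> j \<in> I \<Longrightarrow> i \<noteq> j \<Longrightarrow> ip (v i) (v j) = 0"
  shows "(norm (\<Sum>i\<in>I. scl (a i) (v i)))\<^sup>2 = (\<Sum>i\<in>I. (norm (a i))\<^sup>2 * (norm (v i))\<^sup>2)"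
  using assms
proof (induction I rule: finite_induct)
  case (insert i I)
  have "ip (\<Sum>i\<in>I. scl (a i) (v i)) (scl (a i) (v i)) = 0"
    unfolding ip_sum_left ip_scl_left ip_scl_right sum_distrib_left
    using insert by (intro sum.neutral) auto
  then have "ip (scl (a i) (v i)) (\<Sum>i\<in>I. scl (a i) (v i)) = 0"
    using ip_zero_commute by blast
  from pythagoras[OF this] show ?case
    using insert by (simp add: norm_scl power_mult_distrib)
qed simp

lemma norm_orthonormal_sum:
  assumes "finite I" "orthonormal_on I e"
  shows "(norm (\<Sum>i\<in>I. scl (a i) (e i)))\<^sup>2 = (\<Sum>i\<in>I. (norm (a i))\<^sup>2)"
  using norm_orthogonal_sum[of I e a] assms by (simp add: orthonormal_on_def)

lemma ip_residual_eq_0: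
  assumes "finite I" "orthonormal_on I e" "j \<in> I"
  shows "ip (x - (\<Sum>i\<in>I. scl (ip x (e i)) (e i))) (e j) = 0"
proof -
  have "(\<Sum>i\<in>I. ip x (e i) * ip (e i) (e j)) = (\<Sum>i\<in>I. if i = j then ip x (e i) else 0)"
    using assms by (intro sum.cong) (auto simp: ip_orthonormal)
  also have "\<dots> = ip x (e j)" using assms by simp
  finally show ?thesis by (simp add: ip_diff_left ip_sum_left ip_scl_left)
qed

text \<open>The residual is orthogonal to every \<open>e i\<close>, hence to the projection, and
  Pythagoras applies.\<close>

lemma bessel_decomposition:
  assumes "finite I" "orthonormal_on I e"
  shows "(norm x)\<^sup>2 = (\<Sum>i\<in>I. (norm (ip x (e i)))\<^sup>2)
    + (norm (x - (\<Sum>i\<in>I. scl (ip x (e i)) (e i))))\<^sup>2"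
proof -
  define p where "p = (\<Sum>i\<in>I. scl (ip x (e i)) (e i))"
  have "ip (x - p) (e j) = 0" if "j \<in> I" for j
    using ip_residual_eq_0[OF assms that] by (simp add: p_def)
  then have "ip (e j) (x - p) = 0" if "j \<in> I" for j
    using ip_zero_commute that by blast
  then have "ip p (x - p) = 0"
    unfolding p_def[of] ip_sum_left ip_scl_left by (simp add: p_def)
  from pythagoras[OF this] show ?thesis
    by (simp add: p_def norm_orthonormal_sum[OF assms])
qed

lemma bessel:
  assumes "finite I" "orthonormal_on I e"
  shows "(\<Sum>i\<in>I. (norm (ip x (e i)))\<^sup>2) \<le> (norm x)\<^sup>2"
  using bessel_decomposition[OF assms, of x] by simp

text \<open>Bessel's inequality for the one-element family consisting of \<open>y\<close>
  normalized.\<close>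

lemma cauchy_schwarz: "norm (ip x y) \<le> norm x * norm y"
proof (cases "y = 0")
  case False
  define e where "e = inverse (norm y) *\<^sub>R y"
  have y: "y = norm y *\<^sub>R e" and e: "orthonormal_on {()} (\<lambda>_. e)"
    using False by (auto simp: e_def orthonormal_on_def)
  have "(norm (ip x e))\<^sup>2 \<le> (norm x)\<^sup>2" using bessel[OF _ e, of x] by simp
  then have "norm (ip x e) * norm y \<le> norm x * norm y"
    by (intro mult_right_mono) (simp_all add: power2_le_iff_abs_le)
  moreover have "norm (ip x y) = norm (ip x e) * norm y"
    by (subst y, subst ip_commute) (simp add: ip_scaleR_left ip_commute[of e x])
  ultimately show ?thesis by simp
qed simp

lemma bounded_linear_ip_left: "bounded_linear (\<lambda>x. ip x y)"
  by (rule bounded_linear_intro[where K = "norm y"])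
    (auto simp: ip_add_left ip_scaleR_left cauchy_schwarz)

lemma bounded_linear_scl: "bounded_linear (scl c)"
proof (rule bounded_linear_intro[where K = "norm c"])
  show "scl c (r *\<^sub>R x) = r *\<^sub>R scl c x" for r x
    unfolding scl_of_real[symmetric] by (rule scale_left_commute)
qed (simp_all add: scale_right_distrib norm_scl mult.commute)

text \<open>Each new vector contributes its normalized residual, or nothing if the residual
  vanishes. Membership in the span of \<open>E\<close> is expressed by the expansion formula, the
  form in which it is used later.\<close>

lemma gram_schmidt:
  assumes "finite X"
  shows "\<exists>E. finite E \<and> orthonormal_on E (\<lambda>e. e) \<and> (\<forall>x\<in>X. (\<Sum>e\<in>E. scl (ip x e) e) = x)"
  using assms
proof (induction X rule: finite_induct)
  case empty
  show ?case by (rule exI[of _ "{}"]) (simp add: orthonormal_on_def)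
next
  case (insert x X)
  then obtain E where E: "finite E" "orthonormal_on E (\<lambda>e. e)"
    "\<And>x. x \<in> X \<Longrightarrow> (\<Sum>e\<in>E. scl (ip x e) e) = x" by blast
  define r where "r = x - (\<Sum>e\<in>E. scl (ip x e) e)"
  have r: "ip r e = 0" if "e \<in> E" for e
    using ip_residual_eq_0[OF E(1,2) that, of x] by (simp add: r_def)
  show ?case
  proof (cases "r = 0")
    case True
    then show ?thesis using E by (intro exI[of _ E]) (auto simp: r_def)
  next
    case False
    define u where "u = inverse (norm r) *\<^sub>R r"
    have u: "norm u = 1" "norm r *\<^sub>R u = r" using False by (auto simp: u_def)
    have ue: "ip u e = 0" "ip e u = 0" if "e \<in> E" for e
      using r[OF that] ip_zero_commute[of u e] by (auto simp: u_def ip_scaleR_left)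
    have "u \<notin> E" using ue(1)[of u] ip_self[of u] u(1) by auto
    have on: "orthonormal_on (insert u E) (\<lambda>e. e)"
      using E(2) ue u(1) by (auto simp: orthonormal_on_def)
    \<comment> \<open>The earlier vectors expand in \<open>E\<close> alone, so the new unit vector
      \<open>u\<close> leaves their expansions unchanged.\<close>
    have xu: "ip y u = 0" if "y \<in> X" for y
    proof -
      have "ip y u = (\<Sum>e\<in>E. ip y e * ip e u)"
        using arg_cong[OF E(3)[OF that], of "\<lambda>z. ip z u"] by (simp add: ip_sum_left ip_scl_left)
      then show ?thesis using ue by simp
    qed
    have "ip x u = ip r u + (\<Sum>e\<in>E. ip x e * ip e u)"
      by (simp add: r_def ip_diff_left ip_sum_left ip_scl_left)
    also have "\<dots> = of_real (norm r)"
    proof -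
      have "ip r u = norm r *\<^sub>R ip u u" using u(2) ip_scaleR_left by metis
      then show ?thesis using ue u(1) by (simp add: ip_self scaleR_conv_of_real)
    qed
    finally have "(\<Sum>e\<in>insert u E. scl (ip x e) e) = x"
      using E(1) \<open>u \<notin> E\<close> u(2) by (simp add: scl_of_real r_def)
    moreover have "(\<Sum>e\<in>insert u E. scl (ip y e) e) = y" if "y \<in> X" for y
      using E(1) \<open>u \<notin> E\<close> xu[OF that] E(3)[OF that] by simp
    ultimately show ?thesis using on E(1)
      by (intro exI[of _ "insert u E"]) blast
  qed
qed

lemma independent_orthonormal:
  assumes "orthonormal_on I e"
  shows "independent (e ` I)"
proof -
  note inj = inj_on_orthonormal[OF assms]
  show ?thesis
    unfolding dependent_explicit
  proof clarify
    fix S u v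
    assume S: "finite S" "S \<subseteq> e ` I" "(\<Sum>v\<in>S. scl (u v) v) = 0" "v \<in> S" "u v \<noteq> 0"
    obtain J where J: "J \<subseteq> I" "finite J" "S = e ` J" using S(1,2) finite_subset_image by metis
    then have "(\<Sum>i\<in>J. scl (u (e i)) (e i)) = 0"
      using S(3) inj by (simp add: sum.reindex inj_on_subset)
    then have "(\<Sum>i\<in>J. (norm (u (e i)))\<^sup>2) = 0"
      using norm_orthonormal_sum[OF J(2) orthonormal_on_subset[OF assms J(1)], of "\<lambda>i. u (e i)"] by simp
    then show False using J S by (auto simp: sum_nonneg_eq_0_iff)
  qed
qed

lemma ndim_subspace_orthonormal:
  assumes "orthonormal_on I e" "finite I"
  shows "ndim_subspace scl (card I) (span (e ` I))"
  unfolding ndim_subspace_def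
  using assms independent_orthonormal[OF assms(1)] card_image[OF inj_on_orthonormal[OF assms(1)]]
  by (intro exI[of _ "e ` I"]) simp

section \<open>Orthonormal series and operators defined by them\<close>

text \<open>Pythagoras turns norms of finite blocks of the vector series into blocks of the scalar
  series, so the Cauchy criterion carries over.\<close>

lemma orthonormal_series:
  assumes "orthonormal_on UNIV (e :: nat \<Rightarrow> 'h)" "summable (\<lambda>n. (norm (a n))\<^sup>2)"
  shows "summable (\<lambda>n. scl (a n) (e n))"
    and "(norm (\<Sum>n. scl (a n) (e n)))\<^sup>2 = (\<Sum>n. (norm (a n))\<^sup>2)"
proof -
  have nrm: "(norm (\<Sum>i\<in>I. scl (a i) (e i)))\<^sup>2 = (\<Sum>i\<in>I. (norm (a i))\<^sup>2)" if "finite I" for I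
    using norm_orthonormal_sum that assms(1) orthonormal_on_subset by blast
  show *: "summable (\<lambda>n. scl (a n) (e n))"
    unfolding summable_Cauchy
  proof (intro allI impI)
    fix \<epsilon> :: real assume "\<epsilon> > 0"
    then have "\<epsilon>\<^sup>2 > 0" by simp
    then obtain N where N: "\<And>m n. m \<ge> N \<Longrightarrow> norm (\<Sum>i=m..<n. (norm (a i))\<^sup>2) < \<epsilon>\<^sup>2"
      using assms(2) unfolding summable_Cauchy by blast
    have "norm (\<Sum>i=m..<n. scl (a i) (e i)) < \<epsilon>" if "m \<ge> N" for m n
    proof -
      have "(norm (\<Sum>i=m..<n. scl (a i) (e i)))\<^sup>2 < \<epsilon>\<^sup>2"
        using N[OF that, of n] nrm[of "{m..<n}"] by simp
      then show ?thesis using \<open>\<epsilon> > 0\<close> by (simp add: power_less_imp_less_base)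
    qed
    then show "\<exists>N. \<forall>m\<ge>N. \<forall>n. norm (\<Sum>i=m..<n. scl (a i) (e i)) < \<epsilon>" by blast
  qed
  have "(\<lambda>N. (norm (\<Sum>i<N. scl (a i) (e i)))\<^sup>2) \<longlonglongrightarrow> (norm (\<Sum>n. scl (a n) (e n)))\<^sup>2"
    using summable_LIMSEQ[OF *] by (intro tendsto_intros)
  moreover have "(\<lambda>N. (norm (\<Sum>i<N. scl (a i) (e i)))\<^sup>2) \<longlonglongrightarrow> (\<Sum>n. (norm (a n))\<^sup>2)"
    using summable_LIMSEQ[OF assms(2)] by (simp add: nrm)
  ultimately show "(norm (\<Sum>n. scl (a n) (e n)))\<^sup>2 = (\<Sum>n. (norm (a n))\<^sup>2)"
    using LIMSEQ_unique by blast
qed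

lemma bessel_series:
  assumes "orthonormal_on UNIV (e :: nat \<Rightarrow> 'h)"
  shows "summable (\<lambda>n. (norm (ip x (e n)))\<^sup>2)"
    and "(\<Sum>n. (norm (ip x (e n)))\<^sup>2) \<le> (norm x)\<^sup>2"
proof -
  have "(\<Sum>i<n. (norm (ip x (e i)))\<^sup>2) \<le> (norm x)\<^sup>2" for n
    using bessel[of "{..<n}" e x] assms orthonormal_on_subset by blast
  note le = this
  show *: "summable (\<lambda>n. (norm (ip x (e n)))\<^sup>2)"
    by (rule bounded_imp_summable[where B = "(norm x)\<^sup>2"])
      (simp, simp only: lessThan_Suc_atMost[symmetric] le)
  show "(\<Sum>n. (norm (ip x (e n)))\<^sup>2) \<le> (norm x)\<^sup>2"
    by (rule suminf_le_const[OF * le])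
qed

lemma orthonormal_series_ip:
  assumes "orthonormal_on UNIV (e :: nat \<Rightarrow> 'h)" "summable (\<lambda>n. (norm (a n))\<^sup>2)"
  shows "ip (\<Sum>n. scl (a n) (e n)) (e j) = a j"
proof -
  have "(\<lambda>n. ip (scl (a n) (e n)) (e j)) sums ip (\<Sum>n. scl (a n) (e n)) (e j)"
    using orthonormal_series(1)[OF assms]
    by (intro bounded_linear.sums[OF bounded_linear_ip_left] summable_sums)
  moreover have "(\<lambda>n. ip (scl (a n) (e n)) (e j)) = (\<lambda>n. if n = j then a n else 0)"
    using ip_orthonormal[OF assms(1)] by (auto simp: ip_scl_left)
  moreover have "(\<lambda>n. if n = j then a n else 0) sums a j" by (rule sums_single)
  ultimately show ?thesis using sums_unique2 by metis
qed

lemma ip_orthogonal_expansion: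
  assumes "(\<Sum>e\<in>E. scl (ip x e) e) = x" "\<And>e. e \<in> E \<Longrightarrow> ip w e = 0"
  shows "ip w x = 0"
proof -
  have "ip (\<Sum>e\<in>E. scl (ip x e) e) w = 0"
    unfolding ip_sum_left ip_scl_left using assms(2) ip_zero_commute by (intro sum.neutral) simp
  then show ?thesis using assms(1) ip_zero_commute[of w x] by simp
qed

lemma exists_finite_projection:
  assumes "finite E"
  shows "\<exists>P \<in> bounded_ops scl scl. \<forall>x. blinfun_apply P x = (\<Sum>e\<in>E. scl (ip x e) e)"
proof -
  have "bounded_linear (\<lambda>x. scl (ip x e) e)" for e
    by (rule bounded_linear_intro[where K = "norm e * norm e"])
      (auto simp: ip_add_left scale_left_distrib norm_scl ip_scaleR_left scaleR_conv_of_real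
        scl_of_real_mult mult.assoc[symmetric] cauchy_schwarz mult_right_mono)
  then have "bounded_linear (\<lambda>x. \<Sum>e\<in>E. scl (ip x e) e)" by (intro bounded_linear_sum)
  from bounded_linear_Blinfun_apply[OF this] show ?thesis
    by (intro bexI[of _ "Blinfun (\<lambda>x. \<Sum>e\<in>E. scl (ip x e) e)"])
      (auto simp: bounded_ops_def ip_scl_left scale_sum_right)
qed

text \<open>The operator sends \<open>x\<close> to the series with coefficients
  \<open>ip x (e n)\<close> along \<open>f\<close>. Bessel's inequality for \<open>e\<close> gives
  both convergence and norm at most 1; neither sequence has to be complete.\<close>

lemma exists_partial_isometry:
  assumes e: "orthonormal_on UNIV (e :: nat \<Rightarrow> 'h)" and f: "orthonormal_on UNIV (f :: nat \<Rightarrow> 'h)"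
  shows "\<exists>R \<in> bounded_ops scl scl. (\<forall>n. blinfun_apply R (e n) = f n) \<and>
    (\<forall>x. (\<forall>n. ip x (e n) = 0) \<longrightarrow> blinfun_apply R x = 0)"
proof -
  define R where "R x = (\<Sum>n. scl (ip x (e n)) (f n))" for x
  have sm: "summable (\<lambda>n. scl (ip x (e n)) (f n))" for x
    by (rule orthonormal_series(1)[OF f bessel_series(1)[OF e]])
  have bd: "norm (R x) \<le> norm x" for x
  proof (rule power2_le_imp_le)
    show "(norm (R x))\<^sup>2 \<le> (norm x)\<^sup>2"
      unfolding R_def orthonormal_series(2)[OF f bessel_series(1)[OF e]] by (rule bessel_series(2)[OF e])
  qed simp
  have scl: "R (scl c x) = scl c (R x)" for c x
    unfolding R_def bounded_linear.suminf[OF bounded_linear_scl sm] by (simp add: ip_scl_left)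
  have add: "R (x + y) = R x + R y" for x y
    unfolding R_def suminf_add[OF sm sm] by (simp add: ip_add_left scale_left_distrib)
  have "bounded_linear R"
  proof (rule bounded_linear_intro[where K = 1])
    show "R (r *\<^sub>R x) = r *\<^sub>R R x" for r x using scl[of "of_real r" x] by (simp only: scl_of_real)
  qed (simp_all add: add bd)
  note R = bounded_linear_Blinfun_apply[OF this]
  have "R (e n) = f n" for n
  proof -
    have "(\<lambda>k. scl (ip (e n) (e k)) (f k)) = (\<lambda>k. if k = n then f k else 0)"
      using ip_orthonormal[OF e] by auto
    then show ?thesis using sums_unique[OF sums_single[of n f]] by (simp add: R_def)
  qed
  moreover have "R x = 0" if "\<forall>n. ip x (e n) = 0" for x
    using that by (simp add: R_def)
  ultimately show ?thesis
    using R scl by (intro bexI[of _ "Blinfun R"]) (auto simp: bounded_ops_def)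
qed

end

subsection \<open>Maximizing sequences of compact operators\<close>

locale compact_hilbert_op =
  G: hilbert_space scl' ip' + H: hilbert_space scl ip
  for scl' :: "'k::rc_scalar \<Rightarrow> 'g::banach \<Rightarrow> 'g" and ip' :: "'g \<Rightarrow> 'g \<Rightarrow> 'k"
    and scl :: "'k \<Rightarrow> 'h::banach \<Rightarrow> 'h" and ip :: "'h \<Rightarrow> 'h \<Rightarrow> 'k" +
  fixes A :: "'g \<Rightarrow>\<^sub>L 'h"
  assumes A_bounded_op: "A \<in> bounded_ops scl' scl"
    and A_compact: "compact_op A"
begin

lemma A_scl: "blinfun_apply A (scl' c x) = scl c (blinfun_apply A x)"
  using A_bounded_op by (simp add: bounded_ops_def)

lemma A_sum_scl: "blinfun_apply A (\<Sum>i\<in>I. scl' (a i) (v i)) = (\<Sum>i\<in>I. scl (a i) (blinfun_apply A (v i)))"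
  by (simp add: blinfun.sum_right A_scl)

text \<open>Compactness of \<open>A\<close> enters all later arguments through this sequential
  form.\<close>

lemma A_convergent_subseq:
  assumes "\<And>n. norm (f n) \<le> 1"
  obtains y r where "strict_mono (r :: nat \<Rightarrow> nat)" "(\<lambda>n. blinfun_apply A (f (r n))) \<longlonglongrightarrow> y"
proof -
  have "seq_compact (closure (blinfun_apply A ` cball 0 1))"
    using A_compact by (simp add: compact_op_def compact_eq_seq_compact_metric)
  moreover have "\<forall>n. blinfun_apply A (f n) \<in> closure (blinfun_apply A ` cball 0 1)"
    using assms by (auto intro!: closure_subset[THEN subsetD])
  ultimately show ?thesis using that by (auto elim!: seq_compactE simp: o_def)
qed

section \<open>Maximizers on closed subspaces\<close>

text \<open>The norm of \<open>A\<close> restricted to \<open>S\<close> is attained: a maximizing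
  sequence has a subsequence with convergent images, and that subsequence itself converges.\<close>

lemma exists_maximizer:
  assumes "closed S" "G.subspace S" "w0 \<in> S" "blinfun_apply A w0 \<noteq> 0"
  shows "\<exists>u\<in>S. norm u = 1 \<and> blinfun_apply A u \<noteq> 0 \<and>
    (\<forall>w\<in>S. norm (blinfun_apply A w) \<le> norm (blinfun_apply A u) * norm w)"
proof -
  have scaleR: "r *\<^sub>R w \<in> S" if "w \<in> S" for r w
    using G.subspace_scale[OF assms(2) that, of "of_real r"] by (simp add: G.scl_of_real)
  define V where "V = (\<lambda>w. norm (blinfun_apply A w)) ` (S \<inter> cball 0 1)"
  define \<sigma> where "\<sigma> = Sup V"
  have bdd: "bdd_above V"
    unfolding V_def
    by (intro bdd_aboveI2[where M = "norm A"])
      (auto intro!: order.trans[OF norm_blinfun] mult_left_le)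
  have le1: "norm (blinfun_apply A w) \<le> \<sigma>" if "w \<in> S" "norm w \<le> 1" for w
    unfolding \<sigma>_def using that by (intro cSup_upper[OF _ bdd]) (auto simp: V_def)
  have le: "norm (blinfun_apply A w) \<le> \<sigma> * norm w" if "w \<in> S" for w
  proof (cases "w = 0")
    case False
    have "norm (blinfun_apply A (inverse (norm w) *\<^sub>R w)) \<le> \<sigma>"
      using le1[OF scaleR[OF that]] False by simp
    then show ?thesis using False by (simp add: blinfun.scaleR_right field_simps)
  qed simp
  have "\<sigma> > 0"
  proof -
    have "0 < \<sigma> * norm w0" using le[OF assms(3)] assms(4) by (meson less_le_trans zero_less_norm_iff)
    then show ?thesis by (metis norm_ge_zero not_less mult_nonpos_nonneg)
  qed
  have "V \<noteq> {}" using G.subspace_0[OF assms(2)] by (auto simp: V_def)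
  have "\<exists>w. w \<in> S \<and> norm w \<le> 1 \<and> \<sigma> - inverse (real (Suc n)) < norm (blinfun_apply A w)" for n
  proof -
    have "\<sigma> - inverse (real (Suc n)) < Sup V" by (simp add: \<sigma>_def)
    then obtain v where "v \<in> V" "\<sigma> - inverse (real (Suc n)) < v"
      using less_cSup_iff[OF \<open>V \<noteq> {}\<close> bdd] by blast
    then show ?thesis by (auto simp: V_def)
  qed
  then obtain f where f: "\<And>n. f n \<in> S" "\<And>n. norm (f n) \<le> 1"
    "\<And>n. \<sigma> - inverse (real (Suc n)) < norm (blinfun_apply A (f n))" by metis
  obtain y r where r: "strict_mono r" "(\<lambda>n. blinfun_apply A (f (r n))) \<longlonglongrightarrow> y"
    using A_convergent_subseq[OF f(2)] .
  define h where "h = f \<circ> r"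
  have h: "\<And>n. h n \<in> S" "\<And>n. norm (h n) \<le> 1" "(\<lambda>n. blinfun_apply A (h n)) \<longlonglongrightarrow> y"
    using f r by (auto simp: h_def o_def)
  have "(\<lambda>n. \<sigma> - inverse (real (Suc (r n)))) \<longlonglongrightarrow> \<sigma> - 0"
    using LIMSEQ_subseq_LIMSEQ[OF LIMSEQ_inverse_real_of_nat r(1)]
    by (intro tendsto_intros) (simp add: o_def)
  moreover have "(\<lambda>n. norm (blinfun_apply A (h n))) \<longlonglongrightarrow> norm y"
    by (intro tendsto_norm h)
  ultimately have "\<sigma> - 0 \<le> norm y"
    by (rule LIMSEQ_le) (use f(3) in \<open>auto intro!: exI[of _ 0] less_imp_le simp: h_def simp del: of_nat_Suc\<close>)
  then have y: "\<sigma> \<le> norm y" by simp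
  text \<open>Near-maximality of \<open>h m\<close> and \<open>h n\<close> together with convergence of their images
    makes \<open>norm (h m + h n)\<close> close to 2, so the parallelogram law makes \<open>h\<close> Cauchy.\<close>
  have "Cauchy h"
  proof (rule metric_CauchyI)
    fix \<epsilon> :: real assume "\<epsilon> > 0"
    \<comment> \<open>With \<open>t = min 1 (\<epsilon>\<^sup>2 / 8)\<close>, the norm of
      \<open>h m + h n\<close> exceeds \<open>2 - 2 * t\<close>, and the parallelogram law leaves at
      most \<open>8 * t\<close> for the squared distance. The bound by 1 keeps
      \<open>2 - 2 * t\<close> nonnegative, so that squaring preserves the inequality.\<close>
    define \<delta> where "\<delta> = min 1 (\<epsilon>\<^sup>2 / 8) * \<sigma>"
    have "\<delta> > 0" using \<open>\<sigma> > 0\<close> \<open>\<epsilon> > 0\<close> by (simp add: \<delta>_def)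
    then obtain N where N: "\<And>n. n \<ge> N \<Longrightarrow> norm (blinfun_apply A (h n) - y) < \<delta>"
      using h(3) unfolding LIMSEQ_iff by blast
    have "dist (h m) (h n) < \<epsilon>" if "m \<ge> N" "n \<ge> N" for m n
    proof -
      let ?s = "norm (h m + h n)"
      have "2 * norm y = norm (2 *\<^sub>R y)" by simp
      also have "2 *\<^sub>R y = blinfun_apply A (h m + h n)
          - ((blinfun_apply A (h m) - y) + (blinfun_apply A (h n) - y))"
        by (simp add: blinfun.add_right scaleR_2)
      also have "norm \<dots> \<le> norm (blinfun_apply A (h m + h n))
          + (norm (blinfun_apply A (h m) - y) + norm (blinfun_apply A (h n) - y))"
        by (meson norm_triangle_ineq4 norm_triangle_ineq add_left_mono order_trans)
      also have "\<dots> < \<sigma> * ?s + (\<delta> + \<delta>)"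
        using N[OF that(1)] N[OF that(2)] le[OF G.subspace_add[OF assms(2) h(1) h(1)], of m n] by simp
      finally have "2 * \<sigma> - 2 * \<delta> < \<sigma> * ?s" using y by simp
      moreover define t where "t = min 1 (\<epsilon>\<^sup>2 / 8)"
      moreover have "\<delta> = t * \<sigma>" by (simp add: \<delta>_def t_def)
      ultimately have "\<sigma> * (2 - 2 * t) < \<sigma> * ?s" by (simp add: algebra_simps)
      then have "2 - 2 * t < ?s" using \<open>\<sigma> > 0\<close> by simp
      moreover have t: "t \<le> 1" "t \<le> \<epsilon>\<^sup>2 / 8" "t > 0" using \<open>\<epsilon> > 0\<close> by (auto simp: t_def)
      ultimately have "(2 - 2 * t)\<^sup>2 < ?s\<^sup>2" by (intro power_strict_mono) auto
      moreover have "(norm (h m))\<^sup>2 \<le> 1" "(norm (h n))\<^sup>2 \<le> 1"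
        using h(2) by (auto simp: power_le_one)
      ultimately have "(norm (h m - h n))\<^sup>2 < 4 - (2 - 2 * t)\<^sup>2"
        using G.parallelogram[of "h m" "h n"] by linarith
      also have "\<dots> = 8 * t - 4 * t\<^sup>2" by (simp add: power2_eq_square algebra_simps)
      also have "\<dots> \<le> \<epsilon>\<^sup>2" using t zero_le_power2[of t] by linarith
      finally show ?thesis
        using \<open>\<epsilon> > 0\<close> by (simp add: dist_norm power_less_imp_less_base)
    qed
    then show "\<exists>M. \<forall>m\<ge>M. \<forall>n\<ge>M. dist (h m) (h n) < \<epsilon>" by blast
  qed
  then obtain u where u: "h \<longlonglongrightarrow> u" using Cauchy_convergent_iff convergent_def by blast
  have "u \<in> S" using closed_sequentially[OF assms(1) _ u] h(1) by blast
  have "norm u \<le> 1" by (rule Lim_norm_ubound[OF _ u]) (auto simp: h(2))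
  have "(\<lambda>n. blinfun_apply A (h n)) \<longlonglongrightarrow> blinfun_apply A u"
    by (intro blinfun.tendsto u tendsto_const)
  then have "blinfun_apply A u = y" using h(3) LIMSEQ_unique by blast
  then have \<sigma>: "norm (blinfun_apply A u) = \<sigma>" using y le1[OF \<open>u \<in> S\<close> \<open>norm u \<le> 1\<close>] by simp
  have "\<sigma> \<le> \<sigma> * norm u" using le[OF \<open>u \<in> S\<close>] \<sigma> by simp
  then have "norm u = 1" using \<open>norm u \<le> 1\<close> \<open>\<sigma> > 0\<close> by simp
  then show ?thesis using \<open>u \<in> S\<close> \<sigma> \<open>\<sigma> > 0\<close> le by (intro bexI[of _ u]) auto
qed

text \<open>First variation: were the images not orthogonal, moving \<open>u\<close> slightly
  towards a multiple of \<open>w\<close> would increase the image norm to first order but the norm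
  of the vector only to second order.\<close>

lemma maximizer_orthogonal:
  assumes "G.subspace S" "u \<in> S" "norm u = 1" "w \<in> S" "ip' u w = 0"
    and max: "\<And>v. v \<in> S \<Longrightarrow> norm (blinfun_apply A v) \<le> norm (blinfun_apply A u) * norm v"
  shows "ip (blinfun_apply A u) (blinfun_apply A w) = 0"
proof (rule ccontr)
  let ?\<alpha> = "ip (blinfun_apply A u) (blinfun_apply A w)" and ?s = "norm (blinfun_apply A u)"
  assume \<alpha>: "?\<alpha> \<noteq> 0"
  define p where "p = (norm ?\<alpha>)\<^sup>2"
  have "p > 0" using \<alpha> by (simp add: p_def)
  \<comment> \<open>Multiplying \<open>w\<close> by this scalar makes the inner product of the
    images the positive real \<open>p\<close>.\<close>
  define v where "v = scl' ?\<alpha> w"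
  have "ip (blinfun_apply A u) (blinfun_apply A v) = of_real p"
    unfolding v_def A_scl H.ip_scl_right p_def
    by (metis mult.commute mult_scalar_cnj_of_real)
  then have *: "ip (blinfun_apply A u) (blinfun_apply A (\<epsilon> *\<^sub>R v)) = of_real (\<epsilon> * p)" for \<epsilon>
    unfolding blinfun.scaleR_right H.scl_of_real[symmetric] H.ip_scl_right by simp
  have ineq: "2 * (\<epsilon> * p) \<le> ?s\<^sup>2 * (\<epsilon>\<^sup>2 * (norm v)\<^sup>2)" for \<epsilon>
  proof -
    have vS: "u + \<epsilon> *\<^sub>R v \<in> S"
      unfolding v_def G.scl_of_real[symmetric]
      using assms(1,2,4) by (intro G.subspace_add G.subspace_scale)
    have "?s\<^sup>2 + 2 * (\<epsilon> * p) \<le> (norm (blinfun_apply A (u + \<epsilon> *\<^sub>R v)))\<^sup>2"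
      using H.norm_add_sq_of_ip[OF *[of \<epsilon>]] by (simp add: blinfun.add_right)
    also have "\<dots> \<le> (?s * norm (u + \<epsilon> *\<^sub>R v))\<^sup>2"
      by (intro power_mono max[OF vS]) simp
    also have "(norm (u + \<epsilon> *\<^sub>R v))\<^sup>2 = 1 + \<epsilon>\<^sup>2 * (norm v)\<^sup>2"
    proof -
      have "ip' u (\<epsilon> *\<^sub>R v) = 0"
        using assms(5) by (simp add: v_def G.ip_scl_right flip: G.scl_of_real)
      from G.pythagoras[OF this] show ?thesis using assms(3) by (simp add: power_mult_distrib)
    qed
    then have "(?s * norm (u + \<epsilon> *\<^sub>R v))\<^sup>2 = ?s\<^sup>2 * (1 + \<epsilon>\<^sup>2 * (norm v)\<^sup>2)"
      by (simp add: power_mult_distrib)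
    finally show ?thesis by (simp add: algebra_simps)
  qed
  define q where "q = ?s\<^sup>2 * (norm v)\<^sup>2"
  have "q \<ge> 0" by (simp add: q_def)
  \<comment> \<open>Small enough that the quadratic term cannot balance the linear one; adding 1
    makes the denominator positive without a separate proof that \<open>q\<close> is.\<close>
  define \<epsilon> where "\<epsilon> = p / (q + 1)"
  have "\<epsilon> > 0" using \<open>p > 0\<close> \<open>q \<ge> 0\<close> by (simp add: \<epsilon>_def)
  have "\<epsilon> * (2 * p) \<le> \<epsilon> * (q * \<epsilon>)" using ineq[of \<epsilon>] by (simp add: q_def power2_eq_square mult_ac)
  then have "2 * p \<le> q * \<epsilon>" using \<open>\<epsilon> > 0\<close> by simp
  also have "\<dots> \<le> p" using \<open>p > 0\<close> \<open>q \<ge> 0\<close> by (simp add: \<epsilon>_def field_simps)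
  finally show False using \<open>p > 0\<close> by simp
qed

section \<open>Greedy maximal sequences\<close>

text \<open>These are right singular vectors of \<open>A\<close> restricted to \<open>S\<close>, and
  the norms of their images are the singular values. The set \<open>S\<close> is a parameter because
  both the whole space and a subspace of finite codimension are needed.\<close>

definition maximal_seq :: "'g set \<Rightarrow> (nat \<Rightarrow> 'g) \<Rightarrow> bool" where
  "maximal_seq S g \<longleftrightarrow> (\<forall>n. g n \<in> S \<and> norm (g n) = 1 \<and> blinfun_apply A (g n) \<noteq> 0 \<and>
     (\<forall>i<n. ip' (g n) (g i) = 0) \<and>
     (\<forall>w\<in>S. (\<forall>i<n. ip' w (g i) = 0) \<longrightarrow>
        norm (blinfun_apply A w) \<le> norm (blinfun_apply A (g n)) * norm w))"

lemma subspace_orthogonal: "G.subspace S \<Longrightarrow> G.subspace {w \<in> S. \<forall>i<n. ip' w (g i) = 0}"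
  unfolding G.subspace_def by (auto simp: G.ip_add_left G.ip_scl_left)

lemma closed_orthogonal:
  assumes "closed S"
  shows "closed {w \<in> S. \<forall>i<n::nat. ip' w (g i) = 0}"
proof -
  have "{w \<in> S. \<forall>i<n. ip' w (g i) = 0} = S \<inter> (\<Inter>i\<in>{..<n}. {w. ip' w (g i) = 0})" by auto
  moreover have "closed {w. ip' w (g i) = 0}" for i
    by (intro closed_Collect_eq bounded_linear.continuous_on[OF G.bounded_linear_ip_left]
        continuous_on_id continuous_on_const)
  ultimately show ?thesis using assms by (simp add: closed_Int closed_INT)
qed

text \<open>Dependent choice, with \<open>exists_maximizer\<close> applied to the part of
  \<open>S\<close> orthogonal to the vectors chosen so far. The assumption \<open>ex\<close> ensures
  that \<open>A\<close> does not vanish there, so the choice never stops.\<close>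

lemma exists_maximal_seq:
  assumes "closed S" "G.subspace S"
    and ex: "\<And>F. finite F \<Longrightarrow> \<exists>w\<in>S. (\<forall>f\<in>F. ip' w f = 0) \<and> blinfun_apply A w \<noteq> 0"
  shows "\<exists>g. maximal_seq S g"
  unfolding maximal_seq_def
proof (rule dependent_wellorder_choice[where P = "\<lambda>g n u. u \<in> S \<and> norm u = 1 \<and>
     blinfun_apply A u \<noteq> 0 \<and> (\<forall>i<n. ip' u (g i) = 0) \<and>
     (\<forall>w\<in>S. (\<forall>i<n. ip' w (g i) = 0) \<longrightarrow>
        norm (blinfun_apply A w) \<le> norm (blinfun_apply A u) * norm w)"], goal_cases)
  case (1 u g g' n)
  then show ?case by simp
next
  case (2 n g)
  obtain w where w: "w \<in> S" "\<forall>f\<in>g ` {..<n}. ip' w f = 0" "blinfun_apply A w \<noteq> 0"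
    using ex[of "g ` {..<n}"] by auto
  then have wS: "w \<in> {w \<in> S. \<forall>i<n. ip' w (g i) = 0}" by simp
  obtain u where "u \<in> {w \<in> S. \<forall>i<n. ip' w (g i) = 0}" "norm u = 1" "blinfun_apply A u \<noteq> 0"
    "\<forall>w\<in>{w \<in> S. \<forall>i<n. ip' w (g i) = 0}. norm (blinfun_apply A w) \<le> norm (blinfun_apply A u) * norm w"
    using exists_maximizer[OF closed_orthogonal[OF assms(1)] subspace_orthogonal[OF assms(2)] wS w(3)]
    by (elim bexE conjE)
  then show ?case by (intro exI[of _ u]) simp
qed

context
  fixes S g
  assumes S: "G.subspace S" and max: "maximal_seq S g"
begin

lemma maximal_seqD:
  shows "g n \<in> S" "norm (g n) = 1" "blinfun_apply A (g n) \<noteq> 0" "i < n \<Longrightarrow> ip' (g n) (g i) = 0"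
    and "w \<in> S \<Longrightarrow> (\<And>i. i < n \<Longrightarrow> ip' w (g i) = 0) \<Longrightarrow>
      norm (blinfun_apply A w) \<le> norm (blinfun_apply A (g n)) * norm w"
  using max by (simp_all add: maximal_seq_def)

lemma maximal_seq_orthonormal: "G.orthonormal_on I g"
proof -
  have "ip' (g i) (g j) = 0" if "i \<noteq> j" for i j
    using maximal_seqD(4)[of i j] maximal_seqD(4)[of j i] that G.ip_zero_commute[of "g i" "g j"]
    by (cases "i < j") simp_all
  then show ?thesis by (auto simp: G.orthonormal_on_def maximal_seqD)
qed

lemma maximal_seq_antimono:
  assumes "i \<le> j"
  shows "norm (blinfun_apply A (g j)) \<le> norm (blinfun_apply A (g i))"
  using maximal_seqD(5)[of "g j" i] maximal_seqD assms by simp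

text \<open>For \<open>i < j\<close>, the vector \<open>g j\<close> lies in the subspace on which
  \<open>g i\<close> is a maximizer, so \<open>maximizer_orthogonal\<close> applies.\<close>

lemma maximal_seq_image_orthogonal:
  assumes "i \<noteq> j"
  shows "ip (blinfun_apply A (g i)) (blinfun_apply A (g j)) = 0"
proof -
  have *: "ip (blinfun_apply A (g i)) (blinfun_apply A (g j)) = 0" if "i < j" for i j
  proof (rule maximizer_orthogonal[OF subspace_orthogonal[OF S, of i g]])
    show "ip' (g i) (g j) = 0" using maximal_seqD(4)[OF that] G.ip_zero_commute by blast
  qed (use that maximal_seqD in auto)
  show ?thesis
    using *[of i j] *[of j i] assms H.ip_zero_commute[of "blinfun_apply A (g i)" "blinfun_apply A (g j)"]
    by (cases "i < j") simp_all
qed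

lemma maximal_seq_image_orthonormal:
  "H.orthonormal_on I (\<lambda>i. inverse (norm (blinfun_apply A (g i))) *\<^sub>R blinfun_apply A (g i))"
  unfolding H.orthonormal_on_def
proof (intro conjI ballI impI)
  fix i j :: nat assume "i \<noteq> j"
  then show "ip (inverse (norm (blinfun_apply A (g i))) *\<^sub>R blinfun_apply A (g i))
      (inverse (norm (blinfun_apply A (g j))) *\<^sub>R blinfun_apply A (g j)) = 0"
    unfolding H.scl_of_real[symmetric] H.ip_scl_left H.ip_scl_right
    by (simp add: maximal_seq_image_orthogonal)
qed (simp add: maximal_seqD(3))

text \<open>Both \<open>g\<close> and its images are orthogonal, so Pythagoras computes both norms,
  and the last singular value is the smallest one occurring.\<close>

lemma maximal_seq_lower_bound:
  "norm (blinfun_apply A (g N)) * norm (\<Sum>j\<le>N. scl' (a j) (g j))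
    \<le> norm (blinfun_apply A (\<Sum>j\<le>N. scl' (a j) (g j)))"
proof -
  have "(norm (blinfun_apply A (g N)) * norm (\<Sum>j\<le>N. scl' (a j) (g j)))\<^sup>2
      = (\<Sum>j\<le>N. (norm (a j))\<^sup>2 * (norm (blinfun_apply A (g N)))\<^sup>2)"
    by (simp add: power_mult_distrib G.norm_orthonormal_sum maximal_seq_orthonormal
        sum_distrib_left mult.commute)
  also have "\<dots> \<le> (\<Sum>j\<le>N. (norm (a j))\<^sup>2 * (norm (blinfun_apply A (g j)))\<^sup>2)"
    by (intro sum_mono mult_left_mono power_mono maximal_seq_antimono) auto
  also have "\<dots> = (norm (blinfun_apply A (\<Sum>j\<le>N. scl' (a j) (g j))))\<^sup>2"
    unfolding A_sum_scl
    by (rule H.norm_orthogonal_sum[symmetric]) (auto intro: maximal_seq_image_orthogonal)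
  finally show ?thesis by (rule power2_le_imp_le) simp
qed

text \<open>The min-max principle: \<open>g 0\<close> to \<open>g N\<close> span
  \<open>N + 1\<close> dimensions, so at most \<open>N\<close> linear functionals have a common unit
  zero there, on which \<open>maximal_seq_lower_bound\<close> applies. Abstract functionals cover
  conditions on a vector and on its image alike.\<close>

lemma maximal_seq_dimension_count:
  fixes \<phi> :: "'i \<Rightarrow> 'g \<Rightarrow> 'k"
  assumes "finite I" "card I \<le> N"
    and add: "\<And>i x y. i \<in> I \<Longrightarrow> \<phi> i (x + y) = \<phi> i x + \<phi> i y"
    and hom: "\<And>i c x. i \<in> I \<Longrightarrow> \<phi> i (scl' c x) = c * \<phi> i x"
  shows "\<exists>v\<in>S. norm v = 1 \<and> (\<forall>i\<in>I. \<phi> i v = 0) \<and>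
    norm (blinfun_apply A (g N)) \<le> norm (blinfun_apply A v)"
proof -
  have sum: "\<phi> i (\<Sum>j\<in>J. scl' (a j) (g j)) = (\<Sum>j\<in>J. a j * \<phi> i (g j))"
    if "i \<in> I" "finite J" for i J a
    using that(2)
  proof (induction J rule: finite_induct)
    case empty
    show ?case using hom[OF that(1), of 0 0] by simp
  qed (simp add: add[OF that(1)] hom[OF that(1)])
  obtain a where a: "\<exists>j\<in>{..N}. a j \<noteq> 0" "\<And>i. i \<in> I \<Longrightarrow> (\<Sum>j\<le>N. a j * \<phi> i (g j)) = 0"
    using homogeneous_system_nontrivial[of I "{..N}" "\<lambda>i j. \<phi> i (g j)"] assms(1,2) by auto
  define v where "v = (\<Sum>j\<le>N. scl' (a j) (g j))"
  have "(norm v)\<^sup>2 = (\<Sum>j\<le>N. (norm (a j))\<^sup>2)"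
    by (simp add: v_def G.norm_orthonormal_sum maximal_seq_orthonormal)
  also have "\<dots> > 0" using a(1) by (auto intro!: sum_pos2)
  finally have v: "norm v > 0" by simp
  define u where "u = scl' (of_real (inverse (norm v))) v"
  have u': "u = inverse (norm v) *\<^sub>R v" by (simp only: u_def G.scl_of_real)
  have "v \<in> S" unfolding v_def
    using S maximal_seqD(1) by (intro G.subspace_sum G.subspace_scale) auto
  then have "u \<in> S" unfolding u_def by (rule G.subspace_scale[OF S])
  moreover have "norm u = 1" using v by (simp add: u')
  moreover have "\<phi> i u = 0" if "i \<in> I" for i
    using that by (simp add: u_def v_def hom sum a(2))
  moreover have "norm (blinfun_apply A (g N)) \<le> norm (blinfun_apply A u)"
    using maximal_seq_lower_bound[of N a] v
    by (simp add: u' blinfun.scaleR_right field_simps flip: v_def)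
  ultimately show ?thesis by blast
qed

text \<open>If the limit \<open>L\<close> were positive, any two images would be orthogonal of norm
  at least \<open>L\<close>, hence at least \<open>L\<close> apart, and no subsequence could
  converge.\<close>

lemma maximal_seq_tendsto_0: "(\<lambda>n. norm (blinfun_apply A (g n))) \<longlonglongrightarrow> 0"
proof -
  let ?s = "\<lambda>n. norm (blinfun_apply A (g n))"
  have "decseq ?s" using maximal_seq_antimono by (simp add: antimono_def)
  then obtain L where L: "?s \<longlonglongrightarrow> L" "\<And>n. L \<le> ?s n"
    using decseq_convergent[of ?s 0] by auto
  have "L \<ge> 0" by (rule LIMSEQ_le_const[OF L(1)]) auto
  have "L = 0"
  proof (rule ccontr)
    assume "L \<noteq> 0"
    with \<open>L \<ge> 0\<close> have "L > 0" by simp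
    obtain y r where r: "strict_mono r" "(\<lambda>n. blinfun_apply A (g (r n))) \<longlonglongrightarrow> y"
      by (rule A_convergent_subseq[of g]) (simp_all add: maximal_seqD(2))
    then have "Cauchy (\<lambda>n. blinfun_apply A (g (r n)))" by (simp add: LIMSEQ_imp_Cauchy)
    then obtain N where N: "\<And>m n. m \<ge> N \<Longrightarrow> n \<ge> N \<Longrightarrow>
        norm (blinfun_apply A (g (r m)) - blinfun_apply A (g (r n))) < L"
      using \<open>L > 0\<close> unfolding Cauchy_iff by blast
    have "r N \<noteq> r (Suc N)" using strict_mono_eq[OF r(1)] by simp
    then have "ip (blinfun_apply A (g (r N))) (- blinfun_apply A (g (r (Suc N)))) = 0"
      by (simp add: H.ip_minus_right maximal_seq_image_orthogonal)
    from H.pythagoras[OF this]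
    have "(?s (r N))\<^sup>2 \<le> (norm (blinfun_apply A (g (r N)) - blinfun_apply A (g (r (Suc N)))))\<^sup>2"
      by simp
    also have "\<dots> < L\<^sup>2" using N[of N "Suc N"] by (intro power_strict_mono) auto
    finally show False using L(2)[of "r N"] \<open>L > 0\<close> by (simp add: power_mono leD)
  qed
  then show ?thesis using L(1) by simp
qed

end

end

subsection \<open>Widths and covering operators\<close>

context compact_hilbert_op
begin

section \<open>Kolmogorov widths as singular values\<close>

text \<open>From below, every \<open>n\<close>-dimensional \<open>X\<close> is orthogonal to the
  image of some unit vector of image norm at least that of \<open>g n\<close>. From above, the span
  of the first \<open>n\<close> images is optimal. Both indices start at 0, so there is no
  shift.\<close>

lemma kolmogorov_width_eq:
  assumes g: "maximal_seq UNIV g"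
  shows "kolmogorov_width scl (blinfun_apply A ` cball 0 1) n = norm (blinfun_apply A (g n))"
proof -
  let ?K = "blinfun_apply A ` cball 0 1" and ?s = "\<lambda>n. norm (blinfun_apply A (g n))"
  let ?d = "\<lambda>X x. INF z\<in>X. norm (x - z)"
  note U = G.subspace_UNIV g
  note mD = maximal_seqD[OF U]
  \<comment> \<open>The real-valued infima and suprema obey their defining bounds only on nonempty
    bounded sets, hence the preparations \<open>bddz\<close>, \<open>0\<close> and
    \<open>bddx\<close>.\<close>
  have bddz: "bdd_below ((\<lambda>z. norm (x - z)) ` X)" for x :: 'h and X by (rule bdd_belowI2[of _ 0]) simp
  have 0: "0 \<in> X" if "ndim_subspace scl k X" for k X
    using that H.span_zero by (auto simp: ndim_subspace_def)
  have bddx: "bdd_above (?d X ` ?K)" if "ndim_subspace scl k X" for k X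
  proof (rule bdd_aboveI2)
    fix x assume "x \<in> ?K"
    then obtain w where w: "x = blinfun_apply A w" "norm w \<le> 1" by auto
    have "?d X x \<le> norm (x - 0)" by (rule cINF_lower[OF bddz 0[OF that]])
    also have "\<dots> \<le> norm A * norm w" using norm_blinfun w by simp
    also have "\<dots> \<le> norm A" using w(2) by (simp add: mult_left_le)
    finally show "?d X x \<le> norm A" .
  qed
  have lower: "?s n \<le> (SUP x\<in>?K. ?d X x)" if X: "ndim_subspace scl n X" for X
  proof -
    obtain B where B: "finite B" "card B = n" "X = H.span B"
      using X by (auto simp: ndim_subspace_def)
    have "\<exists>v\<in>UNIV. norm v = 1 \<and> (\<forall>b\<in>B. ip (blinfun_apply A v) b = 0) \<and> ?s n \<le> norm (blinfun_apply A v)"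
      by (rule maximal_seq_dimension_count[OF U])
        (simp_all add: B blinfun.add_right H.ip_add_left A_scl H.ip_scl_left)
    then obtain v where v: "norm v = 1" "\<And>b. b \<in> B \<Longrightarrow> ip (blinfun_apply A v) b = 0"
      "?s n \<le> norm (blinfun_apply A v)" by auto
    have "H.span B \<subseteq> {z. ip (blinfun_apply A v) z = 0}"
      using v(2) by (intro H.span_minimal) (auto simp: H.subspace_def H.ip_add_right H.ip_scl_right)
    then have ort: "ip (blinfun_apply A v) z = 0" if "z \<in> X" for z using that B(3) by auto
    have "?s n \<le> ?d X (blinfun_apply A v)"
    proof (rule cINF_greatest)
      show "X \<noteq> {}" using 0[OF X] by auto
      fix z assume "z \<in> X"
      then have "ip (blinfun_apply A v) (- z) = 0" by (simp add: H.ip_minus_right ort)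
      from H.pythagoras[OF this] have "(norm (blinfun_apply A v))\<^sup>2 \<le> (norm (blinfun_apply A v - z))\<^sup>2"
        by simp
      then have "norm (blinfun_apply A v) \<le> norm (blinfun_apply A v - z)"
        by (rule power2_le_imp_le) simp
      then show "?s n \<le> norm (blinfun_apply A v - z)" using v(3) by simp
    qed
    also have "\<dots> \<le> (SUP x\<in>?K. ?d X x)"
      using v(1) by (intro cSUP_upper bddx[OF X]) simp
    finally show ?thesis .
  qed
  define h where "h i = inverse (?s i) *\<^sub>R blinfun_apply A (g i)" for i
  define X where "X = H.span (h ` {..<n})"
  have s: "?s i > 0" for i using mD(3) by simp
  have AX: "blinfun_apply A (g i) \<in> X" if "i < n" for i
  proof -
    have "blinfun_apply A (g i) = scl (of_real (?s i)) (h i)"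
      using s[of i] by (simp add: h_def H.scl_of_real)
    moreover have "scl (of_real (?s i)) (h i) \<in> X"
      unfolding X_def using that by (intro H.span_scale H.span_base) simp
    ultimately show ?thesis by metis
  qed
  have X: "ndim_subspace scl n X"
    using H.ndim_subspace_orthonormal[OF maximal_seq_image_orthonormal[OF U, of "{..<n}"]]
    by (simp add: X_def h_def)
  have "(SUP x\<in>?K. ?d X x) \<le> ?s n"
  proof (rule cSUP_least)
    fix x assume "x \<in> ?K"
    then obtain w where w: "x = blinfun_apply A w" "norm w \<le> 1" by auto
    \<comment> \<open>Approximating \<open>A w\<close> by \<open>A p\<close> leaves the image of
      \<open>w - p\<close>, which is orthogonal to the first \<open>n\<close> vectors and so is
      controlled by the maximality of \<open>g n\<close>.\<close>
    define p where "p = (\<Sum>i<n. scl' (ip' w (g i)) (g i))"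
    have on: "G.orthonormal_on {..<n} g" by (rule maximal_seq_orthonormal[OF U])
    have "blinfun_apply A p \<in> X"
      unfolding p_def A_sum_scl using AX unfolding X_def
      by (intro H.span_sum H.span_scale) simp
    then have "?d X x \<le> norm (x - blinfun_apply A p)" by (intro cINF_lower bddz)
    also have "\<dots> = norm (blinfun_apply A (w - p))" by (simp add: w blinfun.diff_right)
    also have "\<dots> \<le> ?s n * norm (w - p)"
      by (rule mD(5)) (use G.ip_residual_eq_0[OF _ on] in \<open>simp_all add: p_def\<close>)
    also have "\<dots> \<le> ?s n * 1"
    proof (intro mult_left_mono)
      have "(norm (w - p))\<^sup>2 \<le> (norm w)\<^sup>2"
        using G.bessel_decomposition[OF _ on, of w] by (simp add: p_def sum_nonneg)
      then show "norm (w - p) \<le> 1" using w(2) power2_le_imp_le by (metis norm_ge_zero order_trans)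
    qed simp
    finally show "?d X x \<le> ?s n" by simp
  qed auto
  moreover have "(INF X\<in>{X. ndim_subspace scl n X}. SUP x\<in>?K. ?d X x) \<le> (SUP x\<in>?K. ?d X x)"
    using X lower by (intro cINF_lower bdd_belowI2[of _ "?s n"]) auto
  moreover have "?s n \<le> (INF X\<in>{X. ndim_subspace scl n X}. SUP x\<in>?K. ?d X x)"
    using X lower by (intro cINF_greatest) auto
  ultimately show ?thesis by (simp add: kolmogorov_width_def)
qed

text \<open>If \<open>A\<close> vanished on the orthogonal complement of \<open>F\<close>, the
  images of an orthonormal basis \<open>E\<close> of the span of \<open>F\<close> would span its
  range.\<close>

lemma infinite_rank_orthogonal:
  assumes "\<nexists>n. ndim_subspace scl n (range (blinfun_apply A))" "finite F"
  shows "\<exists>w. (\<forall>f\<in>F. ip' w f = 0) \<and> blinfun_apply A w \<noteq> 0"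
proof (rule ccontr)
  assume no: "\<not> ?thesis"
  obtain E where E: "finite E" "G.orthonormal_on E (\<lambda>e. e)"
    "\<And>f. f \<in> F \<Longrightarrow> (\<Sum>e\<in>E. scl' (ip' f e) e) = f"
    using G.gram_schmidt[OF assms(2)] by auto
  have "blinfun_apply A x \<in> H.span (blinfun_apply A ` E)" for x
  proof -
    define p where "p = (\<Sum>e\<in>E. scl' (ip' x e) e)"
    have "ip' (x - p) e = 0" if "e \<in> E" for e
      using G.ip_residual_eq_0[OF E(1,2) that, of x] by (simp add: p_def)
    then have "ip' (x - p) f = 0" if "f \<in> F" for f
      using G.ip_orthogonal_expansion[OF E(3)[OF that]] by simp
    then have "blinfun_apply A (x - p) = 0" using no by metis
    then have "blinfun_apply A x = blinfun_apply A p" by (simp add: blinfun.diff_right)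
    also have "\<dots> \<in> H.span (blinfun_apply A ` E)"
      unfolding p_def A_sum_scl by (intro H.span_sum H.span_scale H.span_base) simp
    finally show ?thesis .
  qed
  moreover have "H.span (blinfun_apply A ` E) \<subseteq> range (blinfun_apply A)"
  proof (intro H.span_minimal)
    show "H.subspace (range (blinfun_apply A))"
      unfolding H.subspace_def
    proof (intro conjI ballI allI)
      show "0 \<in> range (blinfun_apply A)" by (rule range_eqI[of _ _ 0]) simp
    next
      fix x y assume "x \<in> range (blinfun_apply A)" "y \<in> range (blinfun_apply A)"
      then obtain v w where "x = blinfun_apply A v" "y = blinfun_apply A w" by auto
      then show "x + y \<in> range (blinfun_apply A)"
        by (intro range_eqI[of _ _ "v + w"]) (simp add: blinfun.add_right)
    next
      fix c x assume "x \<in> range (blinfun_apply A)"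
      then obtain v where "x = blinfun_apply A v" by auto
      then show "scl c x \<in> range (blinfun_apply A)"
        by (intro range_eqI[of _ _ "scl' c v"]) (simp add: A_scl)
    qed
  qed auto
  ultimately have rng: "range (blinfun_apply A) = H.span (blinfun_apply A ` E)" by auto
  \<comment> \<open>The images of \<open>E\<close> may be dependent, whereas
    \<open>ndim_subspace\<close> asks for a basis.\<close>
  obtain B where B: "B \<subseteq> blinfun_apply A ` E" "H.independent B" "blinfun_apply A ` E \<subseteq> H.span B"
    using H.basis_exists[of "blinfun_apply A ` E"] by metis
  have "finite B" using finite_subset[OF B(1)] E(1) by simp
  have "H.span B = H.span (blinfun_apply A ` E)"
    using B(1,3) by (intro antisym H.span_mono H.span_minimal H.subspace_span)
  then have "ndim_subspace scl (card B) (range (blinfun_apply A))"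
    unfolding ndim_subspace_def using rng B(2) \<open>finite B\<close>
    by (intro exI[of _ B]) simp
  then show False using assms(1) by blast
qed

section \<open>Construction of the covering operators\<close>

lemma exists_covering_extension:
  assumes g: "maximal_seq UNIV g"
    and c: "c > 0" "\<And>n. c * norm (blinfun_apply A (g n)) \<le> norm (blinfun_apply A (g (Suc n)))"
    and T: "T \<in> bounded_ops scl scl" and E: "finite E" "H.orthonormal_on E (\<lambda>e. e)"
  shows "\<exists>D \<in> covering_ops scl (blinfun_apply A ` cball 0 1).
    \<forall>x. (\<Sum>e\<in>E. scl (ip x e) e) = x \<longrightarrow> blinfun_apply D x = blinfun_apply T x"
proof -
  let ?s = "\<lambda>n. norm (blinfun_apply A (g n))"
  note U = G.subspace_UNIV g
  define m where "m = card E"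
  define k where "k = c ^ m"
  have "k > 0" using c(1) by (simp add: k_def)
  have "c ^ j * ?s n \<le> ?s (n + j)" for j n
  proof (induction j)
    case (Suc j)
    have "c * (c ^ j * ?s n) \<le> c * ?s (n + j)" using Suc c(1) by (intro mult_left_mono) auto
    then show ?case using c(2)[of "n + j"] by (simp add: mult.assoc)
  qed simp
  then have ks: "k * ?s n \<le> ?s (n + m)" for n by (simp add: k_def)
  define S where "S = {w. \<forall>e\<in>E. ip (blinfun_apply A w) e = 0}"
  have S: "G.subspace S"
    unfolding S_def G.subspace_def
    by (auto simp: blinfun.add_right H.ip_add_left A_scl H.ip_scl_left)
  have "closed S"
  proof -
    have "S = (\<Inter>e\<in>E. {w. ip (blinfun_apply A w) e = 0})" by (auto simp: S_def)
    moreover have "closed {w. ip (blinfun_apply A w) e = 0}" for e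
      by (intro closed_Collect_eq bounded_linear.continuous_on[OF H.bounded_linear_ip_left]
          bounded_linear.continuous_on[OF blinfun.bounded_linear_right] continuous_on_id continuous_on_const)
    ultimately show ?thesis by (simp add: closed_INT)
  qed
  \<comment> \<open>Membership in \<open>S\<close> and orthogonality to the vectors
    \<open>f i\<close> form a single family of \<open>card I + m\<close> functionals, indexed by a
    disjoint sum.\<close>
  have count: "\<exists>v\<in>S. norm v = 1 \<and> (\<forall>i\<in>I. ip' v (f i) = 0) \<and> ?s (card I + m) \<le> norm (blinfun_apply A v)"
    if "finite I" for I :: "'i set" and f :: "'i \<Rightarrow> 'g"
  proof -
    let ?\<phi> = "case_sum (\<lambda>i x. ip' x (f i)) (\<lambda>e x. ip (blinfun_apply A x) e)"
    have "\<exists>v\<in>UNIV. norm v = 1 \<and> (\<forall>i\<in>I <+> E. ?\<phi> i v = 0) \<and> ?s (card I + m) \<le> norm (blinfun_apply A v)"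
      using that E(1) by (intro maximal_seq_dimension_count[OF U])
        (auto simp: card_Plus m_def blinfun.add_right H.ip_add_left A_scl H.ip_scl_left
          G.ip_add_left G.ip_scl_left)
    then obtain v where v: "norm v = 1" "\<forall>i\<in>I <+> E. ?\<phi> i v = 0" "?s (card I + m) \<le> norm (blinfun_apply A v)"
      by auto
    have "ip' v (f i) = 0" if "i \<in> I" for i using bspec[OF v(2) InlI[OF that]] by simp
    moreover have "ip (blinfun_apply A v) e = 0" if "e \<in> E" for e using bspec[OF v(2) InrI[OF that]] by simp
    ultimately show ?thesis using v(1,3) by (intro bexI[of _ v]) (auto simp: S_def)
  qed
  have "\<exists>w\<in>S. (\<forall>f\<in>F. ip' w f = 0) \<and> blinfun_apply A w \<noteq> 0" if F: "finite F" for F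
  proof -
    obtain w where w: "w \<in> S" "\<forall>i\<in>F. ip' w i = 0" "?s (card F + m) \<le> norm (blinfun_apply A w)"
      using count[OF F, of "\<lambda>x. x"] by auto
    moreover have "?s (card F + m) > 0" using maximal_seqD(3)[OF U] by simp
    ultimately show ?thesis by (intro bexI[of _ w]) auto
  qed
  from exists_maximal_seq[OF \<open>closed S\<close> S this] obtain g' where g': "maximal_seq S g'" by blast
  let ?t = "\<lambda>n. norm (blinfun_apply A (g' n))"
  have t: "?t n > 0" "?s n > 0" for n
    using maximal_seqD(3)[OF S g'] maximal_seqD(3)[OF U] by simp_all
  \<comment> \<open>The vector from \<open>count\<close> is admissible in the maximization that
    defines \<open>g' n\<close>, so its image norm is at most \<open>?t n\<close>.\<close>
  have kst: "k * ?s n \<le> ?t n" for n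
  proof -
    obtain v where v: "v \<in> S" "norm v = 1" "\<forall>i\<in>{..<n}. ip' v (g' i) = 0" "?s (n + m) \<le> norm (blinfun_apply A v)"
      using count[of "{..<n}" g'] by auto
    then have "norm (blinfun_apply A v) \<le> ?t n"
      using maximal_seqD(5)[OF S g', of v n] by simp
    then show ?thesis using v(4) ks[of n] by simp
  qed
  define h where "h i = inverse (?s i) *\<^sub>R blinfun_apply A (g i)" for i
  define h' where "h' i = inverse (?t i) *\<^sub>R blinfun_apply A (g' i)" for i
  have h: "H.orthonormal_on UNIV h" unfolding h_def by (rule maximal_seq_image_orthonormal[OF U])
  have h': "H.orthonormal_on UNIV h'" unfolding h'_def by (rule maximal_seq_image_orthonormal[OF S g'])
  have Eh': "ip (h' n) e = 0" if "e \<in> E" for e n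
    using maximal_seqD(1)[OF S g', of n] that by (simp add: h'_def H.ip_scaleR_left S_def)
  obtain R where R: "R \<in> bounded_ops scl scl" "\<And>n. blinfun_apply R (h' n) = h n"
    "\<And>x. (\<And>n. ip x (h' n) = 0) \<Longrightarrow> blinfun_apply R x = 0"
    using H.exists_partial_isometry[OF h' h] by blast
  obtain P where P: "P \<in> bounded_ops scl scl" "\<And>x. blinfun_apply P x = (\<Sum>e\<in>E. scl (ip x e) e)"
    using H.exists_finite_projection[OF E(1)] by blast
  \<comment> \<open>The summands do not interfere: \<open>R\<close> vanishes on the span of
    \<open>E\<close> because each \<open>h' n\<close> is orthogonal to it, and \<open>P\<close>
    vanishes on the image of \<open>S\<close>.\<close>
  define D where "D = (T o\<^sub>L P) + inverse k *\<^sub>R R"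
  have D: "blinfun_apply D x = blinfun_apply T (blinfun_apply P x) + inverse k *\<^sub>R blinfun_apply R x" for x
    by (simp add: D_def blinfun.add_left blinfun.scaleR_left)
  have "D \<in> bounded_ops scl scl"
    using T P(1) R(1) unfolding bounded_ops_def mem_Collect_eq D
    by (simp add: H.scale_right_distrib H.scale_left_commute flip: H.scl_of_real)
  moreover have "blinfun_apply D x = blinfun_apply T x" if x: "(\<Sum>e\<in>E. scl (ip x e) e) = x" for x
  proof -
    have "ip (h' n) x = 0" for n using H.ip_orthogonal_expansion[OF x] Eh' by simp
    then have "blinfun_apply R x = 0" using R(3) H.ip_zero_commute by blast
    then show ?thesis by (simp add: D P(2) x)
  qed
  moreover have "blinfun_apply A w \<in> blinfun_apply D ` blinfun_apply A ` cball 0 1" if w: "norm w \<le> 1" for w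
  proof -
    note g_on = maximal_seq_orthonormal[OF U, of UNIV]
    note g'_on = maximal_seq_orthonormal[OF S g', of UNIV]
    define a where "a n = ip' w (g n)" for n
    have a: "summable (\<lambda>n. (norm (a n))\<^sup>2)" "(\<Sum>n. (norm (a n))\<^sup>2) \<le> (norm w)\<^sup>2"
      unfolding a_def by (rule G.bessel_series[OF g_on])+
    \<comment> \<open>The coefficients solve \<open>b n * ?t n = k * a n * ?s n\<close>, so that
      \<open>D\<close> sends the image of \<open>scl' (b n) (g' n)\<close> to that of
      \<open>scl' (a n) (g n)\<close>. By \<open>kst\<close> they are no larger than
      \<open>a n\<close>, which keeps \<open>w'\<close> in the unit ball.\<close>
    define b where "b n = of_real (k * ?s n / ?t n) * a n" for n
    have ba: "(norm (b n))\<^sup>2 \<le> (norm (a n))\<^sup>2" for n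
    proof (rule power_mono)
      have "k * ?s n / ?t n \<ge> 0" "k * ?s n / ?t n \<le> 1"
        using kst[of n] t[of n] \<open>k > 0\<close> by (simp_all add: divide_le_eq)
      then show "norm (b n) \<le> norm (a n)"
        unfolding b_def norm_mult norm_of_real by (intro mult_left_le_one_le) auto
    qed simp
    have b: "summable (\<lambda>n. (norm (b n))\<^sup>2)"
      by (rule summable_comparison_test'[OF a(1), of 0]) (simp add: ba)
    define w' where "w' = (\<Sum>n. scl' (b n) (g' n))"
    have sw': "(\<lambda>n. scl' (b n) (g' n)) sums w'"
      unfolding w'_def using G.orthonormal_series(1)[OF g'_on b] by (rule summable_sums)
    have "(norm w')\<^sup>2 = (\<Sum>n. (norm (b n))\<^sup>2)"
      unfolding w'_def by (rule G.orthonormal_series(2)[OF g'_on b])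
    also have "\<dots> \<le> (\<Sum>n. (norm (a n))\<^sup>2)" by (rule suminf_le[OF ba b a(1)])
    also have "\<dots> \<le> 1" using a(2) w by (meson norm_ge_zero order_trans power_le_one)
    finally have nw': "norm w' \<le> 1" by (simp add: power_le_one_iff)
    have "w' \<in> S"
    proof (rule closed_sequentially[OF \<open>closed S\<close>])
      show "(\<lambda>n. \<Sum>i<n. scl' (b i) (g' i)) \<longlonglongrightarrow> w'" using sw' by (simp add: sums_def)
      show "(\<Sum>i<n. scl' (b i) (g' i)) \<in> S" for n
        using maximal_seqD(1)[OF S g'] by (intro G.subspace_sum[OF S] G.subspace_scale[OF S])
    qed
    then have P0: "blinfun_apply P (blinfun_apply A w') = 0" by (simp add: P(2) S_def)
    define p where "p = (\<Sum>n. scl' (a n) (g n))"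
    have sp: "(\<lambda>n. scl' (a n) (g n)) sums p"
      unfolding p_def using G.orthonormal_series(1)[OF g_on a(1)] by (rule summable_sums)
    have "(\<lambda>n. blinfun_apply R (blinfun_apply A (scl' (b n) (g' n)))) sums blinfun_apply R (blinfun_apply A w')"
      by (intro bounded_linear.sums[OF blinfun.bounded_linear_right] sw')
    moreover have "blinfun_apply R (blinfun_apply A (scl' (b n) (g' n)))
      = k *\<^sub>R blinfun_apply A (scl' (a n) (g n))" for n
    proof -
      have g'n: "blinfun_apply A (g' n) = scl (of_real (?t n)) (h' n)"
        and gn: "scl (of_real (?s n)) (h n) = blinfun_apply A (g n)"
        using t[of n] by (simp_all add: h'_def h_def H.scl_of_real)
      have bt: "b n * of_real (?t n) = of_real k * (a n * of_real (?s n))"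
        using t(1)[of n] by (simp add: b_def field_simps)
      have "blinfun_apply A (scl' (b n) (g' n)) = scl (b n * of_real (?t n)) (h' n)"
        unfolding A_scl by (subst g'n) (rule H.scale_scale)
      then have "blinfun_apply R (blinfun_apply A (scl' (b n) (g' n))) = scl (b n * of_real (?t n)) (h n)"
        using R(1,2) by (simp add: bounded_ops_def)
      also have "\<dots> = scl (of_real k) (scl (a n) (scl (of_real (?s n)) (h n)))"
        unfolding bt H.scale_scale ..
      also have "\<dots> = k *\<^sub>R blinfun_apply A (scl' (a n) (g n))"
        unfolding gn A_scl by (rule H.scl_of_real)
      finally show ?thesis .
    qed
    ultimately have "(\<lambda>n. k *\<^sub>R blinfun_apply A (scl' (a n) (g n))) sums blinfun_apply R (blinfun_apply A w')"
      by simp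
    moreover have "(\<lambda>n. k *\<^sub>R blinfun_apply A (scl' (a n) (g n))) sums (k *\<^sub>R blinfun_apply A p)"
      by (intro sums_scaleR_right bounded_linear.sums[OF blinfun.bounded_linear_right] sp)
    ultimately have "blinfun_apply R (blinfun_apply A w') = k *\<^sub>R blinfun_apply A p"
      using sums_unique2 by blast
    then have "blinfun_apply D (blinfun_apply A w') = blinfun_apply A p"
      using \<open>k > 0\<close> by (simp add: D P0)
    \<comment> \<open>The vector \<open>w - p\<close> is orthogonal to every \<open>g i\<close>, so
      each singular value bounds \<open>A\<close> on it, and these tend to 0.\<close>
    moreover have "blinfun_apply A (w - p) = 0"
    proof -
      have "ip' (w - p) (g i) = 0" for i
        using G.orthonormal_series_ip[OF g_on a(1), of i]
        by (simp add: G.ip_diff_left p_def a_def)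
      then have "norm (blinfun_apply A (w - p)) \<le> ?s n * norm (w - p)" for n
        by (intro maximal_seqD(5)[OF U]) auto
      moreover have "(\<lambda>n. ?s n * norm (w - p)) \<longlonglongrightarrow> 0 * norm (w - p)"
        by (intro tendsto_mult maximal_seq_tendsto_0[OF U] tendsto_const)
      ultimately have "norm (blinfun_apply A (w - p)) \<le> 0"
        by (intro LIMSEQ_le_const) auto
      then show ?thesis by simp
    qed
    ultimately have "blinfun_apply A w = blinfun_apply D (blinfun_apply A w')"
      by (simp add: blinfun.diff_right)
    then show ?thesis using nw' by auto
  qed
  ultimately show ?thesis unfolding covering_ops_def
    by (intro bexI[of _ D]) auto
qed

end

section \<open>Lacunarity and weak operator closure\<close>

text \<open>A positive liminf bounds the ratios from below from some index on; the finitely many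
  earlier ratios are positive as well.\<close>

lemma not_lacunary_ratio_bound:
  assumes "decseq a" "\<And>n. a n > 0" "a \<longlonglongrightarrow> 0" "\<not> lacunary a"
  obtains c where "c > 0" "\<And>n. c * a n \<le> a (Suc n)"
proof -
  let ?q = "\<lambda>n. ereal (a (Suc n) / a n)"
  have "liminf ?q \<noteq> 0" using assms by (simp add: lacunary_def)
  moreover have "liminf ?q \<ge> 0"
    using assms(2) by (intro Liminf_bounded always_eventually) (simp add: less_imp_le)
  ultimately have "0 < liminf ?q" by simp
  then obtain y where y: "0 < y" "y < liminf ?q" using dense by blast
  then have "eventually (\<lambda>n. y < ?q n) sequentially" using less_LiminfD by blast
  then obtain N where N: "\<And>n. n \<ge> N \<Longrightarrow> y < ?q n" by (auto simp: eventually_sequentially)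
  obtain r where r: "0 < r" "ereal r < y" using ereal_dense2[OF y(1)] by (auto simp: zero_ereal_def)
  \<comment> \<open>Inserting \<open>r\<close> covers the indices from \<open>N\<close> on and keeps
    the set nonempty when \<open>N = 0\<close>.\<close>
  define c where "c = Min (insert r ((\<lambda>n. a (Suc n) / a n) ` {..<N}))"
  have "c > 0" using r assms(2) by (simp add: c_def)
  have le: "c \<le> a (Suc n) / a n" for n
  proof (cases "n < N")
    case True
    then show ?thesis unfolding c_def by (intro Min_le) auto
  next
    case False
    then have "ereal r < ?q n" using r(2) N[of n] by (meson not_less order_less_trans)
    moreover have "c \<le> r" unfolding c_def by (intro Min_le) auto
    ultimately show ?thesis by simp
  qed
  have "c * a n \<le> a (Suc n)" for n using le[of n] assms(2)[of n] by (simp add: pos_le_divide_eq)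
  with \<open>c > 0\<close> show ?thesis by (rule that)
qed

text \<open>A basic neighbourhood constrains \<open>ip (D x) y\<close> for finitely many pairs only,
  so agreement with \<open>T\<close> on the first components of these pairs suffices.\<close>

lemma in_wot_closure:
  assumes "T \<in> bounded_ops scl scl" "S \<subseteq> bounded_ops scl scl"
    and "\<And>F. finite F \<Longrightarrow> \<exists>D\<in>S. \<forall>x\<in>F. blinfun_apply D x = blinfun_apply T x"
  shows "T \<in> weak_operator_topology scl ip closure_of S"
  unfolding in_closure_of
proof (intro conjI allI impI)
  let ?f = "\<lambda>T (x, y). ip (blinfun_apply T x) y"
  show "T \<in> topspace (weak_operator_topology scl ip)"
    using assms(1) by (simp add: weak_operator_topology_def topspace_pullback_topology)
  fix U assume "T \<in> U \<and> openin (weak_operator_topology scl ip) U"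
  then obtain V where V: "open V" "U = ?f -` V \<inter> bounded_ops scl scl" "?f T \<in> V"
    by (auto simp: weak_operator_topology_def openin_pullback_topology)
  \<comment> \<open>The Euclidean topology on functions of a pair is the product topology, which
    supplies a basic box around the image of \<open>T\<close>.\<close>
  have "openin (product_topology (\<lambda>_. euclidean) UNIV) V"
    using V(1) by (simp add: open_fun_def)
  from product_topology_open_contains_basis[OF this V(3)] obtain X where
    X: "?f T \<in> (\<Pi>\<^sub>E i\<in>UNIV. X i)" "finite {i. X i \<noteq> UNIV}" "(\<Pi>\<^sub>E i\<in>UNIV. X i) \<subseteq> V"
    by auto
  obtain D where D: "D \<in> S" "\<And>x. x \<in> fst ` {i. X i \<noteq> UNIV} \<Longrightarrow> blinfun_apply D x = blinfun_apply T x"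
    using assms(3)[OF finite_imageI[OF X(2), of fst]] by metis
  have "?f D i \<in> X i" for i
  proof (cases "X i = UNIV")
    case False
    then have "?f D i = ?f T i" using D(2)[of "fst i"] by (auto simp: case_prod_beta)
    then show ?thesis using X(1) by (metis PiE_mem UNIV_I)
  qed simp
  then have "?f D \<in> V" using X(3) by (auto simp: PiE_def)
  then show "\<exists>D. D \<in> S \<and> D \<in> U" using D(1) V(2) assms(2) by auto
qed

theorem theorem4p6:
  fixes scl :: "'k::rc_scalar \<Rightarrow> 'h::banach \<Rightarrow> 'h"
    and ip :: "'h \<Rightarrow> 'h \<Rightarrow> 'k"
    and scl' :: "'k \<Rightarrow> 'g::banach \<Rightarrow> 'g"
    and ip' :: "'g \<Rightarrow> 'g \<Rightarrow> 'k"
    and A :: "'g \<Rightarrow>\<^sub>L 'h"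
    and K :: "'h set"
  assumes "hilbert_space scl ip"
    and "hilbert_space scl' ip'"
    and "ellipsoid_of scl' scl A K"
    and "\<not> lacunary (kolmogorov_width scl K)"
  shows "wot_covering_ops scl ip K = bounded_ops scl scl"
proof
  have K: "K = blinfun_apply A ` cball 0 1" and rank: "\<nexists>n. ndim_subspace scl n (range (blinfun_apply A))"
    and A: "A \<in> bounded_ops scl' scl" "compact_op A"
    using assms(3) by (simp_all add: ellipsoid_of_def)
  interpret compact_hilbert_op scl' ip' scl ip A
    using assms(1,2) A by (simp add: compact_hilbert_op_def compact_hilbert_op_axioms_def)
  show "wot_covering_ops scl ip K \<subseteq> bounded_ops scl scl"
    using closure_of_subset_topspace[of "weak_operator_topology scl ip"]
    by (auto simp: wot_covering_ops_def weak_operator_topology_def topspace_pullback_topology)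
  obtain g where g: "maximal_seq UNIV g"
    using exists_maximal_seq[OF closed_UNIV G.subspace_UNIV] infinite_rank_orthogonal[OF rank] by auto
  note U = G.subspace_UNIV g
  have "kolmogorov_width scl K = (\<lambda>n. norm (blinfun_apply A (g n)))"
    using kolmogorov_width_eq[OF g] K by auto
  then have nl: "\<not> lacunary (\<lambda>n. norm (blinfun_apply A (g n)))" using assms(4) by simp
  obtain c where c: "c > 0" "\<And>n. c * norm (blinfun_apply A (g n)) \<le> norm (blinfun_apply A (g (Suc n)))"
  \<comment> \<open>The singular values decrease, are positive and tend to 0, so failing to be
    lacunary can only mean that the liminf of ratios is not 0.\<close>
  proof (rule not_lacunary_ratio_bound[OF _ _ maximal_seq_tendsto_0[OF U] nl])
    show "decseq (\<lambda>n. norm (blinfun_apply A (g n)))"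
      using maximal_seq_antimono[OF U] by (simp add: antimono_def)
  qed (use maximal_seqD(3)[OF U] in auto)
  show "bounded_ops scl scl \<subseteq> wot_covering_ops scl ip K"
  proof
    fix T :: "'h \<Rightarrow>\<^sub>L 'h" assume T: "T \<in> bounded_ops scl scl"
    show "T \<in> wot_covering_ops scl ip K"
      unfolding wot_covering_ops_def
    proof (rule in_wot_closure[OF T])
      show "covering_ops scl K \<subseteq> bounded_ops scl scl" by (auto simp: covering_ops_def)
      fix F :: "'h set" assume "finite F"
      then obtain E where E: "finite E" "H.orthonormal_on E (\<lambda>e. e)"
        "\<And>x. x \<in> F \<Longrightarrow> (\<Sum>e\<in>E. scl (ip x e) e) = x"
        using H.gram_schmidt by metis
      show "\<exists>D\<in>covering_ops scl K. \<forall>x\<in>F. blinfun_apply D x = blinfun_apply T x"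
        using exists_covering_extension[OF g c T E(1,2)] E(3) K by auto
    qed
  qed
qed

end
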